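(* Let $f(u,v,s)=\big(u,\ u^2f_{21}(u)+v^2+usf_{24}(u,s),\ u^2f_{31}(u)+v^2f_{32}(u,v,s)+usf_{34}(u,s)\big)$ with $f_{32}=c_0(u,s)+vc_1(u,s)+v^2c_2(u,v^2,s)+v^3c_3(u,v^2,s)$, $c_0(0,0)=0$, $c_3(0,0,0)\ne0$, and $c_1(u,s)=s+usd_1(s)+u^2d_2(s)+u^3d_3(s)+u^4d_4(u,s)$ with $d_2(0)>0$; put $d_{20}=\sqrt{d_2(0)}$. For $\tilde s\ne0$ small, let $u(\tilde s)$ be the smooth function with $c_1(u(\tilde s),-\tilde s^2)=0$ and $u(\tilde s)=\tilde s/d_{20}+O(\tilde s^2)$, so that $f(\cdot,\cdot,-\tilde s^2)$ has a cuspidal cross cap at $(u(\tilde s),0)$. Then the bias $r_b$ and the secondary cuspidal curvature $r_c$ of $f(\cdot,\cdot,-\tilde s^2)$ at $(u(\tilde s),0)$ have the expansions $$r_b=6c_2(0,0,0)+\frac{6\big(-2f_{21}(0)(c_0)_u(0,0)+(c_2)_u(0,0,0)\big)}{d_{20}}\tilde s+O_{\tilde s}(2),$$ $$r_c=45\sqrt2\,c_3(0,0,0)+\frac{45\sqrt2\,(c_3)_u(0,0,0)}{d_{20}}\tilde s+O_{\tilde s}(2).$$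
   Context: Let $h:(\mathbb{R}^2,p)\to\mathbb{R}^3$ be a frontal with singular set $\{v=0\}$ near $p=(u_0,0)$. Let $\tilde\eta$ be a vector field such that along $\{v=0\}$: $\tilde\eta h=0$, $\langle h_u,\tilde\eta^2h\rangle=\langle h_u,\tilde\eta^3h\rangle=0$, where $\tilde\eta^k h$ denotes the $k$-fold iterated directional derivative of $h$ along $\tilde\eta$; and let $\ell\in\mathbb{R}$ satisfy $\tilde\eta^3h(p)=\ell\,\tilde\eta^2h(p)$. The bias is $r_b=\dfrac{|h_u|^2\det(h_u,\tilde\eta^2h,\tilde\eta^4h)}{|h_u\times\tilde\eta^2h|^3}$ at $p$, and the secondary cuspidal curvature is $r_c=\dfrac{|h_u|^{5/2}\det(h_u,\tilde\eta^2h,3\tilde\eta^5h-10\ell\,\tilde\eta^4h)}{|h_u\times\tilde\eta^2h|^{7/2}}$ at $p$. $O_{\tilde s}(n)$ denotes terms of degree at least $n$ in $\tilde s$.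
   Formalization: The vector field η̃ is additionally required to be nonvanishing near p with positive v-component at p, since replacing η̃ by −η̃ (and ℓ by −ℓ) flips the sign of r_c, so its sign is otherwise undefined. *)

theory Defs
  imports "HOL-Analysis.Analysis"
begin

fun Cn_on :: "nat \<Rightarrow> 'a::real_normed_vector set \<Rightarrow> ('a \<Rightarrow> 'b::real_normed_vector) \<Rightarrow> bool" where
  "Cn_on 0 S g = continuous_on S g"
| "Cn_on (Suc n) S g = (g differentiable_on S \<and>
      (\<forall>w. Cn_on n S (\<lambda>x. frechet_derivative g (at x) w)))"

definition smooth_on :: "'a::real_normed_vector set \<Rightarrow> ('a \<Rightarrow> 'b::real_normed_vector) \<Rightarrow> bool" where
  "smooth_on S g = (\<forall>n. Cn_on n S g)"

definition dirderiv :: "(real \<times> real \<Rightarrow> real \<times> real) \<Rightarrow> (real \<times> real \<Rightarrow> 'b::real_normed_vector)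
    \<Rightarrow> real \<times> real \<Rightarrow> 'b" where
  "dirderiv X g x = frechet_derivative g (at x) (X x)"

definition iter_dirderiv :: "(real \<times> real \<Rightarrow> real \<times> real) \<Rightarrow> nat \<Rightarrow> (real \<times> real \<Rightarrow> 'b::real_normed_vector)
    \<Rightarrow> real \<times> real \<Rightarrow> 'b" where
  "iter_dirderiv X k g = (dirderiv X ^^ k) g"

definition partial_u :: "(real \<times> real \<Rightarrow> 'b::real_normed_vector) \<Rightarrow> real \<times> real \<Rightarrow> 'b" where
  "partial_u g x = frechet_derivative g (at x) (1, 0)"

definition det3 :: "real^3 \<Rightarrow> real^3 \<Rightarrow> real^3 \<Rightarrow> real" where
  "det3 a b c = det (vector [a, b, c] :: real^3^3)"

text \<open>Admissibility of (eta, l) for a frontal h with singular set {v = 0} near p = (u0,0):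
  eta is smooth near p, eta h = 0, <h_u, eta^2 h> = <h_u, eta^3 h> = 0 along {v=0} near p,
  eta^3 h(p) = l eta^2 h(p); eta is normalised to be nonvanishing near p and such that
  (d/du, eta(p)) is positively oriented (second component of eta(p) positive).\<close>
definition admissible_field ::
  "(real \<times> real \<Rightarrow> real^3) \<Rightarrow> real \<times> real \<Rightarrow> (real \<times> real \<Rightarrow> real \<times> real) \<Rightarrow> real \<Rightarrow> bool" where
  "admissible_field h p eta l \<longleftrightarrow> snd p = 0 \<and>
     (\<exists>e>0. smooth_on (ball p e) eta \<and> (\<forall>x\<in>ball p e. eta x \<noteq> 0) \<and>
        (\<forall>t. \<bar>t - fst p\<bar> < e \<longrightarrow>
           iter_dirderiv eta 1 h (t, 0) = 0 \<and>
           partial_u h (t, 0) \<bullet> iter_dirderiv eta 2 h (t, 0) = 0 \<and>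
           partial_u h (t, 0) \<bullet> iter_dirderiv eta 3 h (t, 0) = 0)) \<and>
     snd (eta p) > 0 \<and>
     iter_dirderiv eta 3 h p = l *\<^sub>R iter_dirderiv eta 2 h p"

definition bias :: "(real \<times> real \<Rightarrow> real^3) \<Rightarrow> real \<times> real \<Rightarrow> (real \<times> real \<Rightarrow> real \<times> real) \<Rightarrow> real" where
  "bias h p eta =
     (norm (partial_u h p))^2 *
       det3 (partial_u h p) (iter_dirderiv eta 2 h p) (iter_dirderiv eta 4 h p)
     / (norm (cross3 (partial_u h p) (iter_dirderiv eta 2 h p)))^3"

definition sec_cusp_curv ::
  "(real \<times> real \<Rightarrow> real^3) \<Rightarrow> real \<times> real \<Rightarrow> (real \<times> real \<Rightarrow> real \<times> real) \<Rightarrow> real \<Rightarrow> real" where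
  "sec_cusp_curv h p eta l =
     norm (partial_u h p) powr (5/2) *
       det3 (partial_u h p) (iter_dirderiv eta 2 h p)
            (3 *\<^sub>R iter_dirderiv eta 5 h p - (10 * l) *\<^sub>R iter_dirderiv eta 4 h p)
     / norm (cross3 (partial_u h p) (iter_dirderiv eta 2 h p)) powr (7/2)"

definition c1_of :: "(real \<Rightarrow> real) \<Rightarrow> (real \<Rightarrow> real) \<Rightarrow> (real \<Rightarrow> real) \<Rightarrow> (real \<times> real \<Rightarrow> real)
    \<Rightarrow> real \<Rightarrow> real \<Rightarrow> real" where
  "c1_of d1 d2 d3 d4 u s = s + u * s * d1 s + u^2 * d2 s + u^3 * d3 s + u^4 * d4 (u, s)"

definition f32_of :: "(real \<times> real \<Rightarrow> real) \<Rightarrow> (real \<Rightarrow> real) \<Rightarrow> (real \<Rightarrow> real) \<Rightarrow> (real \<Rightarrow> real)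
    \<Rightarrow> (real \<times> real \<Rightarrow> real) \<Rightarrow> (real \<times> real \<times> real \<Rightarrow> real) \<Rightarrow> (real \<times> real \<times> real \<Rightarrow> real)
    \<Rightarrow> real \<Rightarrow> real \<Rightarrow> real \<Rightarrow> real" where
  "f32_of c0 d1 d2 d3 d4 c2 c3 u v s =
     c0 (u, s) + v * c1_of d1 d2 d3 d4 u s + v^2 * c2 (u, v^2, s) + v^3 * c3 (u, v^2, s)"

definition f_map :: "(real \<Rightarrow> real) \<Rightarrow> (real \<times> real \<Rightarrow> real) \<Rightarrow> (real \<Rightarrow> real) \<Rightarrow> (real \<times> real \<Rightarrow> real)
    \<Rightarrow> (real \<Rightarrow> real \<Rightarrow> real \<Rightarrow> real) \<Rightarrow> real \<Rightarrow> real \<times> real \<Rightarrow> real^3" where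
  "f_map f21 f24 f31 f34 f32 s = (\<lambda>(u, v).
     vector [u,
             u^2 * f21 u + v^2 + u * s * f24 (u, s),
             u^2 * f31 u + v^2 * f32 u v s + u * s * f34 (u, s)])"

end

theory Submission
  imports Defs "HOL-Library.Landau_Symbols"
begin

text \<open>
  For fixed \<open>s\<close> the map has the form \<open>h = (u, A(u) + v\<^sup>2, B(u) + v\<^sup>2 c\<^sub>0 + v\<^sup>3 c\<^sub>1 + v\<^sup>4 c\<^sub>2 + v\<^sup>5 c\<^sub>3)\<close>.
  The numbers \<open>\<eta>\<^sup>k g(p)\<close> obey the Leibniz rule, so \<open>\<eta>\<^sup>k h(p)\<close> for \<open>k \<le> 5\<close> is determined by the
  jets \<open>x\<^sub>k = \<eta>\<^sup>k u(p)\<close> and \<open>y\<^sub>k = \<eta>\<^sup>k v(p)\<close>.  Admissibility forces \<open>x\<^sub>1 = 0\<close>, \<open>x\<^sub>2 = y\<^sub>1\<^sup>2 \<xi>\<close> with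
  \<open>\<xi> = - 2 (A' + c\<^sub>0 B') / (1 + A'\<^sup>2 + B'\<^sup>2)\<close>, \<open>y\<^sub>2 = l y\<^sub>1 / 3\<close> and \<open>x\<^sub>3 = l x\<^sub>2\<close>; after this substitution all
  remaining jets cancel from both determinants, and the bias and the secondary cuspidal curvature
  become closed expressions in \<open>A', B', A'', B'', c\<^sub>0, c\<^sub>0', c\<^sub>1', c\<^sub>2, c\<^sub>3\<close> at \<open>p\<close>.  Since \<open>A'\<close>, \<open>B'\<close>,
  \<open>c\<^sub>0\<close> and \<open>c\<^sub>1'\<close> all vanish at the origin, both norms are constant up to \<open>O(t\<^sup>2)\<close>, and only the terms
  \<open>c\<^sub>2 + c\<^sub>0' \<xi> / 2\<close> and \<open>c\<^sub>3\<close> contribute to first order along \<open>(u(t), - t\<^sup>2)\<close>.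
\<close>

section \<open>Smooth functions\<close>

lemma Cn_on_Suc_differentiable:
  assumes "Cn_on (Suc n) S g" "open S" "x \<in> S"
  shows "g differentiable (at x)"
  using assms by (auto simp: differentiable_on_eq_differentiable_at)

lemma Cn_on_Suc_has_derivative:
  "Cn_on (Suc n) S g \<Longrightarrow> open S \<Longrightarrow> x \<in> S \<Longrightarrow> (g has_derivative frechet_derivative g (at x)) (at x)"
  using Cn_on_Suc_differentiable frechet_derivative_works by blast

text \<open>\<open>Cn_on\<close> differentiates along the full filter \<open>at x\<close>; since
  \<open>S\<close> is open, the values on \<open>S\<close> alone determine these derivatives, and
  \<open>g\<close> inherits them from \<open>f\<close> order by order.\<close>

lemma Cn_on_cong:
  assumes "open S" "Cn_on n S f" "\<And>x. x \<in> S \<Longrightarrow> f x = g x"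
  shows "Cn_on n S g"
  using assms(2,3)
proof (induction n arbitrary: f g)
  case 0
  then show ?case by (simp cong: continuous_on_cong)
next
  case (Suc n)
  have d: "(g has_derivative frechet_derivative f (at x)) (at x)" if "x \<in> S" for x
    using has_derivative_transform_within_open[of f _ x UNIV S g] Suc.prems that assms(1)
      Cn_on_Suc_has_derivative[OF Suc.prems(1) assms(1) that] by blast
  then have "g differentiable_on S"
    by (meson differentiable_at_imp_differentiable_on differentiableI)
  moreover have "Cn_on n S (\<lambda>x. frechet_derivative g (at x) w)" for w
  proof (rule Suc.IH)
    show "Cn_on n S (\<lambda>x. frechet_derivative f (at x) w)" using Suc.prems(1) by simp
    show "frechet_derivative f (at x) w = frechet_derivative g (at x) w" if "x \<in> S" for x
      using frechet_derivative_at[OF d[OF that]] by simp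
  qed
  ultimately show ?case by simp
qed

text \<open>\<open>frechet_derivative\<close> is a choice term; by uniqueness any explicit
  derivative \<open>G\<close> may stand in for it. The successor steps for addition, scaling and
  composition start here.\<close>

lemma Cn_on_SucI:
  assumes "open S" "\<And>x. x \<in> S \<Longrightarrow> (g has_derivative G x) (at x)"
    and "\<And>w. Cn_on n S (\<lambda>x. G x w)"
  shows "Cn_on (Suc n) S g"
proof -
  have "g differentiable_on S"
    using assms(2) by (meson differentiable_at_imp_differentiable_on differentiableI)
  moreover have "Cn_on n S (\<lambda>x. frechet_derivative g (at x) w)" for w
  proof (rule Cn_on_cong[OF assms(1)])
    show "Cn_on n S (\<lambda>x. G x w)" by (rule assms(3))
    show "G x w = frechet_derivative g (at x) w" if "x \<in> S" for x
      using frechet_derivative_at[OF assms(2)[OF that]] by simp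
  qed
  ultimately show ?thesis by simp
qed

text \<open>Product and chain rule leave one factor undifferentiated while the order drops by one,
  so regularity must be lowered for that factor.\<close>

lemma Cn_on_SucD:
  assumes "open S" "Cn_on (Suc n) S g"
  shows "Cn_on n S g"
  using assms(2)
proof (induction n arbitrary: g)
  case 0
  then show ?case by (simp add: differentiable_imp_continuous_on)
qed simp

lemma Cn_on_subset:
  assumes "Cn_on n S g" "T \<subseteq> S"
  shows "Cn_on n T g"
  using assms
  by (induction n arbitrary: g) (auto intro: continuous_on_subset differentiable_on_subset)

lemma Cn_on_const: "Cn_on n S (\<lambda>x. c)"
  by (induction n arbitrary: c) (auto simp: differentiable_on_def)

lemma Cn_on_linear:
  assumes "bounded_linear L" "open S"
  shows "Cn_on n S L"
proof (cases n)
  case 0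
  then show ?thesis using assms by (simp add: linear_continuous_on)
next
  case (Suc m)
  then show ?thesis
    using Cn_on_SucI[OF assms(2), of L "\<lambda>x. L"] assms(1)
    by (auto intro: bounded_linear_imp_has_derivative Cn_on_const)
qed

lemma Cn_on_add:
  assumes "open S" "Cn_on n S f" "Cn_on n S g"
  shows "Cn_on n S (\<lambda>x. f x + g x)"
  using assms(2,3)
proof (induction n arbitrary: f g)
  case 0
  then show ?case by (simp add: continuous_on_add)
next
  case (Suc n)
  show ?case
  proof (rule Cn_on_SucI[OF assms(1)])
    fix x assume "x \<in> S"
    then show "((\<lambda>x. f x + g x) has_derivative
        (\<lambda>w. frechet_derivative f (at x) w + frechet_derivative g (at x) w)) (at x)"
      using Suc.prems Cn_on_Suc_differentiable[OF _ assms(1)] frechet_derivative_works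
      by (blast intro: has_derivative_add)
  qed (use Suc in auto)
qed

lemma Cn_on_scaleR:
  assumes "open S" "Cn_on n S f" "Cn_on n S g"
  shows "Cn_on n S (\<lambda>x. f x *\<^sub>R g x)"
  using assms(2,3)
proof (induction n arbitrary: f g)
  case 0
  then show ?case by (simp add: continuous_on_scaleR)
next
  case (Suc n)
  show ?case
  proof (rule Cn_on_SucI[OF assms(1)])
    fix x assume "x \<in> S"
    then show "((\<lambda>x. f x *\<^sub>R g x) has_derivative
        (\<lambda>w. f x *\<^sub>R frechet_derivative g (at x) w + frechet_derivative f (at x) w *\<^sub>R g x)) (at x)"
      using Suc.prems[THEN Cn_on_Suc_has_derivative, OF assms(1)]
      by (intro has_derivative_scaleR)
  next
    fix w
    have "Cn_on n S f" "Cn_on n S g"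
      using Suc.prems Cn_on_SucD[OF assms(1)] by blast+
    then show "Cn_on n S (\<lambda>x. f x *\<^sub>R frechet_derivative g (at x) w
        + frechet_derivative f (at x) w *\<^sub>R g x)"
      using Suc.prems by (intro Cn_on_add[OF assms(1)] Suc.IH) auto
  qed
qed

lemma Cn_on_sum:
  assumes "open S" "finite B" "\<And>b. b \<in> B \<Longrightarrow> Cn_on n S (f b)"
  shows "Cn_on n S (\<lambda>x. \<Sum>b\<in>B. f b x)"
  using assms(2,3) by induction (auto intro: Cn_on_const Cn_on_add[OF assms(1)])

lemma Cn_on_linear_compose:
  assumes "open S" "bounded_linear L" "Cn_on n S f"
  shows "Cn_on n S (\<lambda>x. L (f x))"
  using assms(3)
proof (induction n arbitrary: f)
  case 0
  then show ?case using assms(2) by (simp add: bounded_linear.continuous_on)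
next
  case (Suc n)
  show ?case
  proof (rule Cn_on_SucI[OF assms(1)])
    fix x assume "x \<in> S"
    then show "((\<lambda>x. L (f x)) has_derivative (\<lambda>w. L (frechet_derivative f (at x) w))) (at x)"
      using Suc.prems Cn_on_Suc_differentiable[OF _ assms(1)] frechet_derivative_works
        bounded_linear.has_derivative[OF assms(2)] by blast
  qed (use Suc in auto)
qed

text \<open>The chain rule evaluates the derivative of \<open>g\<close> in a direction that moves
  with \<open>x\<close>, whereas \<open>Cn_on\<close> speaks of fixed directions. Expanding the
  direction in the finite basis of \<open>'b\<close> gives a finite sum of products whose factors
  all have order \<open>n\<close>.\<close>

lemma Cn_on_compose:
  fixes f :: "'a::real_normed_vector \<Rightarrow> 'b::euclidean_space" and g :: "'b \<Rightarrow> 'c::real_normed_vector"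
  assumes "open S" "open T" "f ` S \<subseteq> T" "Cn_on n S f" "Cn_on n T g"
  shows "Cn_on n S (\<lambda>x. g (f x))"
  using assms(4,5)
proof (induction n arbitrary: g)
  case 0
  then show ?case using assms(3) continuous_on_compose2[of T g S f] by simp
next
  case (Suc n)
  let ?F = "\<lambda>x. frechet_derivative f (at x)"
  let ?G = "\<lambda>y. frechet_derivative g (at y)"
  have f': "(f has_derivative ?F x) (at x)" if "x \<in> S" for x
    using that Suc.prems(1) Cn_on_Suc_differentiable assms(1) frechet_derivative_works by blast
  have g': "(g has_derivative ?G y) (at y)" if "y \<in> T" for y
    using that Suc.prems(2) Cn_on_Suc_differentiable assms(2) frechet_derivative_works by blast
  show ?case
  proof (rule Cn_on_SucI[OF assms(1)])
    fix x assume x: "x \<in> S"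
    then have fx: "f x \<in> T" using assms(3) by auto
    have "((\<lambda>x. g (f x)) has_derivative (\<lambda>w. ?G (f x) (?F x w))) (at x)"
      using has_derivative_compose[OF f'[OF x] g'[OF fx]] .
    moreover have "?G (f x) y = (\<Sum>b\<in>Basis. (y \<bullet> b) *\<^sub>R ?G (f x) b)" for y
    proof -
      interpret G: linear "?G (f x)"
        using g'[OF fx] has_derivative_linear by blast
      have "?G (f x) y = ?G (f x) (\<Sum>b\<in>Basis. (y \<bullet> b) *\<^sub>R b)"
        by (simp add: euclidean_representation)
      then show ?thesis by (simp add: G.sum G.scale)
    qed
    then have "(\<lambda>w. ?G (f x) (?F x w)) = (\<lambda>w. \<Sum>b\<in>Basis. (?F x w \<bullet> b) *\<^sub>R ?G (f x) b)"
      by (intro ext)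
    ultimately show "((\<lambda>x. g (f x)) has_derivative
        (\<lambda>w. \<Sum>b\<in>Basis. (?F x w \<bullet> b) *\<^sub>R ?G (f x) b)) (at x)"
      by (rule has_derivative_eq_rhs)
  next
    fix w
    have "Cn_on n S (\<lambda>x. ?F x w \<bullet> b)" for b
      using Suc.prems(1) Cn_on_linear_compose[OF assms(1) bounded_linear_inner_left] by fastforce
    moreover have "Cn_on n S (\<lambda>x. ?G (f x) b)" for b
      using Suc.prems Cn_on_SucD[OF assms(1), of n f] Suc.IH[of "\<lambda>y. ?G y b"] by auto
    ultimately show "Cn_on n S (\<lambda>x. \<Sum>b\<in>Basis. (?F x w \<bullet> b) *\<^sub>R ?G (f x) b)"
      by (intro Cn_on_sum[OF assms(1)] Cn_on_scaleR[OF assms(1)]) auto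
  qed
qed

section \<open>Closure properties of smooth functions\<close>

lemma smooth_on_frechet:
  assumes "smooth_on S g"
  shows "smooth_on S (\<lambda>x. frechet_derivative g (at x) w)"
  unfolding smooth_on_def using assms smooth_on_def Cn_on.simps(2) by blast

lemma smooth_on_has_derivative:
  assumes "smooth_on S g" "open S" "x \<in> S"
  shows "(g has_derivative frechet_derivative g (at x)) (at x)"
  using Cn_on_Suc_differentiable[of 0 S g x] assms frechet_derivative_works
  unfolding smooth_on_def by blast

lemma smooth_on_subset: "smooth_on S g \<Longrightarrow> T \<subseteq> S \<Longrightarrow> smooth_on T g"
  using Cn_on_subset unfolding smooth_on_def by blast

lemma smooth_on_cong:
  "open S \<Longrightarrow> smooth_on S f \<Longrightarrow> (\<And>x. x \<in> S \<Longrightarrow> f x = g x) \<Longrightarrow> smooth_on S g"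
  using Cn_on_cong unfolding smooth_on_def by blast

lemma smooth_on_const: "smooth_on S (\<lambda>x. c)"
  by (simp add: smooth_on_def Cn_on_const)

lemma smooth_on_linear: "open S \<Longrightarrow> bounded_linear L \<Longrightarrow> smooth_on S L"
  by (simp add: smooth_on_def Cn_on_linear)

lemma smooth_on_linear_compose:
  "open S \<Longrightarrow> bounded_linear L \<Longrightarrow> smooth_on S f \<Longrightarrow> smooth_on S (\<lambda>x. L (f x))"
  by (simp add: smooth_on_def Cn_on_linear_compose)

lemma smooth_on_id: "open S \<Longrightarrow> smooth_on S (\<lambda>x. x)"
  using smooth_on_linear bounded_linear_ident by blast

lemma smooth_on_fst: "open S \<Longrightarrow> smooth_on S fst"
  using smooth_on_linear bounded_linear_fst by blast

lemma smooth_on_snd: "open S \<Longrightarrow> smooth_on S snd"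
  using smooth_on_linear bounded_linear_snd by blast

lemma smooth_on_add:
  "open S \<Longrightarrow> smooth_on S f \<Longrightarrow> smooth_on S g \<Longrightarrow> smooth_on S (\<lambda>x. f x + g x)"
  by (simp add: smooth_on_def Cn_on_add)

lemma smooth_on_scaleR:
  "open S \<Longrightarrow> smooth_on S f \<Longrightarrow> smooth_on S g \<Longrightarrow> smooth_on S (\<lambda>x. f x *\<^sub>R g x)"
  by (simp add: smooth_on_def Cn_on_scaleR)

lemma smooth_on_mult:
  fixes f g :: "'a::real_normed_vector \<Rightarrow> real"
  shows "open S \<Longrightarrow> smooth_on S f \<Longrightarrow> smooth_on S g \<Longrightarrow> smooth_on S (\<lambda>x. f x * g x)"
  using smooth_on_scaleR[of S f g] by simp

lemma smooth_on_power:
  fixes f :: "'a::real_normed_vector \<Rightarrow> real"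
  assumes "open S" "smooth_on S f"
  shows "smooth_on S (\<lambda>x. f x ^ k)"
  using assms by (induction k) (auto intro: smooth_on_const smooth_on_mult)

lemma smooth_on_compose:
  fixes f :: "'a::real_normed_vector \<Rightarrow> 'b::euclidean_space"
  shows "open S \<Longrightarrow> open T \<Longrightarrow> smooth_on S f \<Longrightarrow> smooth_on T g \<Longrightarrow> f ` S \<subseteq> T \<Longrightarrow>
    smooth_on S (\<lambda>x. g (f x))"
  unfolding smooth_on_def using Cn_on_compose by blast

lemma smooth_on_Pair:
  assumes "open S" "smooth_on S f" "smooth_on S g"
  shows "smooth_on S (\<lambda>x. (f x, g x))"
proof -
  \<comment> \<open>As a sum of two linear embeddings the pair needs no derivative computation of
    its own.\<close>
  have "smooth_on S (\<lambda>x. (f x, 0) + (0, g x))"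
    using assms
    by (intro smooth_on_add smooth_on_linear_compose[of _ "\<lambda>y. (y, 0)"]
      smooth_on_linear_compose[of _ "\<lambda>y. (0, y)"] bounded_linear_Pair
      bounded_linear_ident bounded_linear_zero) auto
  then show ?thesis by simp
qed

lemma smooth_on_has_real_derivative:
  fixes g :: "real \<Rightarrow> real"
  assumes "smooth_on S g" "open S" "x \<in> S"
  shows "(g has_real_derivative deriv g x) (at x)"
  using smooth_on_has_derivative[OF assms] differentiableI DERIV_deriv_iff_real_differentiable
  by blast

lemma smooth_on_deriv:
  fixes g :: "real \<Rightarrow> real"
  assumes "open S" "smooth_on S g"
  shows "smooth_on S (deriv g)"
proof (rule smooth_on_cong[OF assms(1) smooth_on_frechet[OF assms(2), of 1]])
  fix x assume "x \<in> S"
  then have "(g has_derivative (\<lambda>w. deriv g x * w)) (at x)"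
    using smooth_on_has_real_derivative[OF assms(2,1)] by (simp add: has_field_derivative_def)
  then show "frechet_derivative g (at x) 1 = deriv g x"
    using frechet_derivative_at[of g "\<lambda>w. deriv g x * w" x] by (simp add: fun_eq_iff) (metis mult.right_neutral)
qed

section \<open>Iterated directional derivatives\<close>

locale smooth_field =
  fixes S :: "(real \<times> real) set" and X :: "real \<times> real \<Rightarrow> real \<times> real"
  assumes open_S: "open S" and smooth_X: "smooth_on S X"
begin

abbreviation D :: "nat \<Rightarrow> (real \<times> real \<Rightarrow> 'b::real_normed_vector) \<Rightarrow> real \<times> real \<Rightarrow> 'b"
  where "D \<equiv> iter_dirderiv X"

lemma D_0 [simp]: "D 0 g = g"
  by (simp add: iter_dirderiv_def)

lemma D_Suc: "D (Suc k) g = dirderiv X (D k g)"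
  by (simp add: iter_dirderiv_def)

text \<open>Peels off the innermost derivative, where \<open>D_Suc\<close> peels off the outermost;
  the product and chain rules act on the innermost one.\<close>

lemma D_Suc_shift: "D (Suc k) g = D k (dirderiv X g)"
  by (simp add: iter_dirderiv_def funpow_swap1)

lemma dirderiv_eqI: "(g has_derivative g') (at x) \<Longrightarrow> dirderiv X g x = g' (X x)"
  unfolding dirderiv_def using frechet_derivative_at by metis

text \<open>The direction \<open>X x\<close> varies with \<open>x\<close>, so it is split along
  \<open>(1, 0)\<close> and \<open>(0, 1)\<close> with smooth coefficients.\<close>

lemma smooth_on_dirderiv:
  assumes "smooth_on S g"
  shows "smooth_on S (dirderiv X g)"
proof -
  let ?G = "\<lambda>x. frechet_derivative g (at x)"
  have smooth: "smooth_on S (\<lambda>x. fst (X x) *\<^sub>R ?G x (1, 0) + snd (X x) *\<^sub>R ?G x (0, 1))"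
    using smooth_on_linear_compose[OF open_S bounded_linear_fst smooth_X]
      smooth_on_linear_compose[OF open_S bounded_linear_snd smooth_X] smooth_on_frechet[OF assms]
    by (intro smooth_on_add smooth_on_scaleR open_S)
  show ?thesis
  proof (rule smooth_on_cong[OF open_S smooth])
    fix x assume "x \<in> S"
    then interpret G: linear "?G x"
      using smooth_on_has_derivative[OF assms open_S] has_derivative_linear by blast
    have "?G x (X x) = ?G x (fst (X x) *\<^sub>R (1, 0) + snd (X x) *\<^sub>R (0, 1))" by simp
    then show "fst (X x) *\<^sub>R ?G x (1, 0) + snd (X x) *\<^sub>R ?G x (0, 1) = dirderiv X g x"
      unfolding dirderiv_def G.add G.scale by simp
  qed
qed

lemma smooth_on_D: "smooth_on S g \<Longrightarrow> smooth_on S (D k g)"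
  by (induction k) (auto simp: D_Suc intro: smooth_on_dirderiv)

lemma dirderiv_cong:
  assumes "smooth_on S f" "\<And>x. x \<in> S \<Longrightarrow> f x = g x" "x \<in> S"
  shows "dirderiv X f x = dirderiv X g x"
proof -
  have "(g has_derivative frechet_derivative f (at x)) (at x)"
    using has_derivative_transform_within_open[OF smooth_on_has_derivative[OF assms(1) open_S assms(3)]
      open_S assms(3)] assms(2) by blast
  then show ?thesis using dirderiv_eqI by (metis dirderiv_def)
qed

text \<open>Product and chain identities are known only on \<open>S\<close>; its openness lets them
  pass through further derivatives.\<close>

lemma D_cong:
  assumes "smooth_on S f" "\<And>x. x \<in> S \<Longrightarrow> f x = g x" "x \<in> S"
  shows "D k f x = D k g x"
  using assms(3)
proof (induction k arbitrary: x)
  case 0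
  then show ?case using assms(2) by simp
next
  case (Suc k)
  then show ?case using dirderiv_cong[OF smooth_on_D[OF assms(1)]] by (simp add: D_Suc)
qed

lemma dirderiv_add:
  assumes "smooth_on S f" "smooth_on S g" "x \<in> S"
  shows "dirderiv X (\<lambda>x. f x + g x) x = dirderiv X f x + dirderiv X g x"
  using dirderiv_eqI[OF has_derivative_add[OF smooth_on_has_derivative[OF assms(1) open_S assms(3)]
    smooth_on_has_derivative[OF assms(2) open_S assms(3)]]]
  by (simp add: dirderiv_def)

lemma dirderiv_mult:
  fixes f g :: "real \<times> real \<Rightarrow> real"
  assumes "smooth_on S f" "smooth_on S g" "x \<in> S"
  shows "dirderiv X (\<lambda>x. f x * g x) x = dirderiv X f x * g x + f x * dirderiv X g x"
  using dirderiv_eqI[OF has_derivative_mult[OF smooth_on_has_derivative[OF assms(1) open_S assms(3)]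
    smooth_on_has_derivative[OF assms(2) open_S assms(3)]]]
  by (simp add: dirderiv_def)

lemma D_add:
  assumes "smooth_on S f" "smooth_on S g" "x \<in> S"
  shows "D k (\<lambda>x. f x + g x) x = D k f x + D k g x"
  using assms(3)
proof (induction k arbitrary: x)
  case (Suc k)
  have "smooth_on S (D k (\<lambda>x. f x + g x))"
    by (intro smooth_on_D smooth_on_add open_S assms)
  then have "dirderiv X (D k (\<lambda>x. f x + g x)) x = dirderiv X (\<lambda>x. D k f x + D k g x) x"
    by (rule dirderiv_cong) (use Suc in auto)
  then show ?case
    using dirderiv_add[OF smooth_on_D smooth_on_D] assms(1,2) Suc.prems by (simp add: D_Suc)
qed simp

lemma D_linear:
  assumes "bounded_linear L" "smooth_on S f" "x \<in> S"
  shows "D k (\<lambda>x. L (f x)) x = L (D k f x)"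
  using assms(3)
proof (induction k arbitrary: x)
  case (Suc k)
  have "smooth_on S (D k (\<lambda>x. L (f x)))"
    by (intro smooth_on_D smooth_on_linear_compose[OF open_S assms(1,2)])
  then have "dirderiv X (D k (\<lambda>x. L (f x))) x = dirderiv X (\<lambda>x. L (D k f x)) x"
    by (rule dirderiv_cong) (use Suc in auto)
  moreover have "\<dots> = L (dirderiv X (D k f) x)"
    using dirderiv_eqI[OF bounded_linear.has_derivative[OF assms(1)
      smooth_on_has_derivative[OF smooth_on_D[OF assms(2)] open_S Suc.prems]]]
    by (simp add: dirderiv_def)
  ultimately show ?case by (simp add: D_Suc)
qed simp

text \<open>Differentiating the product first and applying \<open>D k\<close> afterwards reduces
  order \<open>k + 1\<close> to order \<open>k\<close> for two products; Pascal's rule then yields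
  the binomial coefficients in \<open>D_mult\<close>.\<close>

lemma D_mult_Suc:
  fixes f g :: "real \<times> real \<Rightarrow> real"
  assumes "smooth_on S f" "smooth_on S g" "x \<in> S"
  shows "D (Suc k) (\<lambda>x. f x * g x) x = D k (\<lambda>x. D 1 f x * g x) x + D k (\<lambda>x. f x * D 1 g x) x"
proof -
  note [intro] = smooth_on_mult smooth_on_dirderiv smooth_on_add open_S assms
  have "D k (dirderiv X (\<lambda>x. f x * g x)) x
      = D k (\<lambda>x. dirderiv X f x * g x + f x * dirderiv X g x) x"
    by (rule D_cong) (auto simp: dirderiv_mult assms)
  also have "\<dots> = D k (\<lambda>x. dirderiv X f x * g x) x + D k (\<lambda>x. f x * dirderiv X g x) x"
    by (rule D_add) auto
  finally show ?thesis by (simp add: D_Suc_shift)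
qed

lemma D_D: "D j (D k g) = D (j + k) g"
  by (simp add: iter_dirderiv_def funpow_add)

lemma D_mult:
  fixes f g :: "real \<times> real \<Rightarrow> real"
  assumes "smooth_on S f" "smooth_on S g" "x \<in> S"
  shows "D 1 (\<lambda>x. f x * g x) x = D 1 f x * g x + f x * D 1 g x"
    and "D 2 (\<lambda>x. f x * g x) x = D 2 f x * g x + 2 * D 1 f x * D 1 g x + f x * D 2 g x"
    and "D 3 (\<lambda>x. f x * g x) x = D 3 f x * g x + 3 * D 2 f x * D 1 g x + 3 * D 1 f x * D 2 g x
           + f x * D 3 g x"
    and "D 4 (\<lambda>x. f x * g x) x = D 4 f x * g x + 4 * D 3 f x * D 1 g x + 6 * D 2 f x * D 2 g x
           + 4 * D 1 f x * D 3 g x + f x * D 4 g x"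
    and "D 5 (\<lambda>x. f x * g x) x = D 5 f x * g x + 5 * D 4 f x * D 1 g x + 10 * D 3 f x * D 2 g x
           + 10 * D 2 f x * D 3 g x + 5 * D 1 f x * D 4 g x + f x * D 5 g x"
proof -
  \<comment> \<open>Each order is proved for arbitrary smooth \<open>p\<close> and \<open>q\<close>,
    because the next one applies it to the pairs \<open>D 1 p\<close>, \<open>q\<close> and
    \<open>p\<close>, \<open>D 1 q\<close>.\<close>
  have 1: "D 1 (\<lambda>x. p x * q x) x = D 1 p x * q x + p x * D 1 q x"
    if "smooth_on S p" "smooth_on S q" for p q :: "real \<times> real \<Rightarrow> real"
    using dirderiv_mult[OF that assms(3)] by (simp add: iter_dirderiv_def)
  have 2: "D 2 (\<lambda>x. p x * q x) x = D 2 p x * q x + 2 * D 1 p x * D 1 q x + p x * D 2 q x"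
    if "smooth_on S p" "smooth_on S q" for p q :: "real \<times> real \<Rightarrow> real"
    using D_mult_Suc[OF that assms(3), of 1] that
    by (simp add: 1 smooth_on_D D_D del: One_nat_def)
  have 3: "D 3 (\<lambda>x. p x * q x) x = D 3 p x * q x + 3 * D 2 p x * D 1 q x + 3 * D 1 p x * D 2 q x
           + p x * D 3 q x"
    if "smooth_on S p" "smooth_on S q" for p q :: "real \<times> real \<Rightarrow> real"
    using D_mult_Suc[OF that assms(3), of 2] that
    by (simp add: 1 2 smooth_on_D D_D del: One_nat_def)
  have 4: "D 4 (\<lambda>x. p x * q x) x = D 4 p x * q x + 4 * D 3 p x * D 1 q x + 6 * D 2 p x * D 2 q x
           + 4 * D 1 p x * D 3 q x + p x * D 4 q x"
    if "smooth_on S p" "smooth_on S q" for p q :: "real \<times> real \<Rightarrow> real"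
    using D_mult_Suc[OF that assms(3), of 3] that
    by (simp add: 1 2 3 smooth_on_D D_D del: One_nat_def)
  have 5: "D 5 (\<lambda>x. p x * q x) x = D 5 p x * q x + 5 * D 4 p x * D 1 q x + 10 * D 3 p x * D 2 q x
           + 10 * D 2 p x * D 3 q x + 5 * D 1 p x * D 4 q x + p x * D 5 q x"
    if "smooth_on S p" "smooth_on S q" for p q :: "real \<times> real \<Rightarrow> real"
    using D_mult_Suc[OF that assms(3), of 4] that
    by (simp add: 1 2 3 4 smooth_on_D D_D del: One_nat_def)
  show "D 1 (\<lambda>x. f x * g x) x = D 1 f x * g x + f x * D 1 g x"
    and "D 2 (\<lambda>x. f x * g x) x = D 2 f x * g x + 2 * D 1 f x * D 1 g x + f x * D 2 g x"
    and "D 3 (\<lambda>x. f x * g x) x = D 3 f x * g x + 3 * D 2 f x * D 1 g x + 3 * D 1 f x * D 2 g x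
           + f x * D 3 g x"
    and "D 4 (\<lambda>x. f x * g x) x = D 4 f x * g x + 4 * D 3 f x * D 1 g x + 6 * D 2 f x * D 2 g x
           + 4 * D 1 f x * D 3 g x + f x * D 4 g x"
    and "D 5 (\<lambda>x. f x * g x) x = D 5 f x * g x + 5 * D 4 f x * D 1 g x + 10 * D 3 f x * D 2 g x
           + 10 * D 2 f x * D 3 g x + 5 * D 1 f x * D 4 g x + f x * D 5 g x"
    using 1[OF assms(1,2)] 2[OF assms(1,2)] 3[OF assms(1,2)] 4[OF assms(1,2)] 5[OF assms(1,2)]
    by blast+
qed

section \<open>Jets of the coordinates and of functions of the first coordinate\<close>

lemma D_fst_1: "D 1 fst x = fst (X x)"
  using dirderiv_eqI[OF bounded_linear_imp_has_derivative[OF bounded_linear_fst]]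
  by (simp add: iter_dirderiv_def)

lemma D_snd_1: "D 1 snd x = snd (X x)"
  using dirderiv_eqI[OF bounded_linear_imp_has_derivative[OF bounded_linear_snd]]
  by (simp add: iter_dirderiv_def)

lemma D_fst_Suc: "D (Suc k) fst = D k (\<lambda>x. fst (X x))"
  using D_D[of k 1 fst, symmetric] ext[of "D 1 fst", OF D_fst_1] by simp

lemma D_snd_Suc: "D (Suc k) snd = D k (\<lambda>x. snd (X x))"
  using D_D[of k 1 snd, symmetric] ext[of "D 1 snd", OF D_snd_1] by simp

context
  fixes I :: "real set"
  assumes open_I: "open I" and fst_S: "fst ` S \<subseteq> I"
begin

lemma smooth_on_compose_fst:
  "smooth_on I \<phi> \<Longrightarrow> smooth_on S (\<lambda>x. \<phi> (fst x))"
  by (rule smooth_on_compose[OF open_S open_I smooth_on_fst[OF open_S] _ fst_S])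

lemma dirderiv_compose_fst:
  fixes \<phi> :: "real \<Rightarrow> real"
  assumes "smooth_on I \<phi>" "x \<in> S"
  shows "dirderiv X (\<lambda>x. \<phi> (fst x)) x = deriv \<phi> (fst x) * fst (X x)"
proof -
  have "(\<phi> has_derivative (\<lambda>w. deriv \<phi> (fst x) * w)) (at (fst x))"
    using smooth_on_has_real_derivative[OF assms(1) open_I] assms(2) fst_S
    by (auto simp: has_field_derivative_def)
  with bounded_linear_imp_has_derivative[OF bounded_linear_fst]
  have "((\<lambda>x. \<phi> (fst x)) has_derivative (\<lambda>w. deriv \<phi> (fst x) * fst w)) (at x)"
    by (rule has_derivative_compose)
  then show ?thesis by (rule dirderiv_eqI)
qed

lemma D_compose_fst_Suc:
  fixes \<phi> :: "real \<Rightarrow> real"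
  assumes "smooth_on I \<phi>" "x \<in> S"
  shows "D (Suc k) (\<lambda>x. \<phi> (fst x)) x = D k (\<lambda>x. deriv \<phi> (fst x) * D 1 fst x) x"
  unfolding D_Suc_shift
  by (rule D_cong)
    (auto simp: dirderiv_compose_fst D_fst_1 assms simp del: One_nat_def
      intro!: smooth_on_dirderiv smooth_on_compose_fst)

text \<open>Faa di Bruno's formula with vanishing first jet: only partitions into blocks of size at
  least two survive. The 3 counts the splittings of four elements into 2 + 2, the 10 those of five
  into 2 + 3.\<close>

lemma D_compose_fst:
  fixes \<phi> :: "real \<Rightarrow> real"
  assumes \<phi>: "smooth_on I \<phi>" and x: "x \<in> S" "D 1 fst x = 0"
  shows "D 1 (\<lambda>x. \<phi> (fst x)) x = 0"
    and "D 2 (\<lambda>x. \<phi> (fst x)) x = deriv \<phi> (fst x) * D 2 fst x"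
    and "D 3 (\<lambda>x. \<phi> (fst x)) x = deriv \<phi> (fst x) * D 3 fst x"
    and "D 4 (\<lambda>x. \<phi> (fst x)) x = deriv \<phi> (fst x) * D 4 fst x
           + 3 * deriv (deriv \<phi>) (fst x) * (D 2 fst x)\<^sup>2"
    and "D 5 (\<lambda>x. \<phi> (fst x)) x = deriv \<phi> (fst x) * D 5 fst x
           + 10 * deriv (deriv \<phi>) (fst x) * D 2 fst x * D 3 fst x"
proof -
  note D_Suc_eq = D_D[of 1 1 fst] D_D[of 2 1 fst] D_D[of 3 1 fst] D_D[of 4 1 fst]
  have s1: "smooth_on S (D 1 fst)"
    by (intro smooth_on_D smooth_on_fst open_S)
  \<comment> \<open>The low orders hold for every \<open>\<psi>\<close>, since the higher ones apply
    them to \<open>deriv \<phi>\<close>.\<close>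
  have one: "D 1 (\<lambda>x. \<psi> (fst x)) x = 0" if "smooth_on I \<psi>" for \<psi> :: "real \<Rightarrow> real"
    using D_compose_fst_Suc[OF that x(1), of 0] x(2) by simp
  have two: "D 2 (\<lambda>x. \<psi> (fst x)) x = deriv \<psi> (fst x) * D 2 fst x"
    if "smooth_on I \<psi>" for \<psi> :: "real \<Rightarrow> real"
  proof -
    have s: "smooth_on I (deriv \<psi>)" using smooth_on_deriv open_I that by blast
    show ?thesis
      using D_compose_fst_Suc[OF that x(1), of 1] D_mult(1)[OF smooth_on_compose_fst[OF s] s1 x(1)]
      by (simp add: D_Suc_eq one[OF s] x(2) del: One_nat_def)
  qed
  have three: "D 3 (\<lambda>x. \<psi> (fst x)) x = deriv \<psi> (fst x) * D 3 fst x"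
    if "smooth_on I \<psi>" for \<psi> :: "real \<Rightarrow> real"
  proof -
    have s: "smooth_on I (deriv \<psi>)" using smooth_on_deriv open_I that by blast
    show ?thesis
      using D_compose_fst_Suc[OF that x(1), of 2] D_mult(2)[OF smooth_on_compose_fst[OF s] s1 x(1)]
      by (simp add: D_Suc_eq one[OF s] x(2) del: One_nat_def)
  qed
  have s: "smooth_on I (deriv \<phi>)" using smooth_on_deriv open_I \<phi> by blast
  show "D 1 (\<lambda>x. \<phi> (fst x)) x = 0"
    and "D 2 (\<lambda>x. \<phi> (fst x)) x = deriv \<phi> (fst x) * D 2 fst x"
    and "D 3 (\<lambda>x. \<phi> (fst x)) x = deriv \<phi> (fst x) * D 3 fst x"
    using one two three \<phi> by blast+
  show "D 4 (\<lambda>x. \<phi> (fst x)) x = deriv \<phi> (fst x) * D 4 fst x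
           + 3 * deriv (deriv \<phi>) (fst x) * (D 2 fst x)\<^sup>2"
    using D_compose_fst_Suc[OF \<phi> x(1), of 3] D_mult(3)[OF smooth_on_compose_fst[OF s] s1 x(1)]
    by (simp add: D_Suc_eq one[OF s] two[OF s] x(2) power2_eq_square del: One_nat_def)
  show "D 5 (\<lambda>x. \<phi> (fst x)) x = deriv \<phi> (fst x) * D 5 fst x
           + 10 * deriv (deriv \<phi>) (fst x) * D 2 fst x * D 3 fst x"
    using D_compose_fst_Suc[OF \<phi> x(1), of 4] D_mult(4)[OF smooth_on_compose_fst[OF s] s1 x(1)]
    by (simp add: D_Suc_eq one[OF s] two[OF s] three[OF s] x(2) algebra_simps del: One_nat_def)
qed

end

end

section \<open>The invariants in normal form\<close>

text \<open>The parameter \<open>s\<close> is frozen. The two top coefficients depend on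
  \<open>(u, v)\<close>, because in the application they are \<open>c2\<close> and \<open>c3\<close>
  evaluated at \<open>(u, v^2, s)\<close>.\<close>

definition cusp_map :: "(real \<Rightarrow> real) \<Rightarrow> (real \<Rightarrow> real) \<Rightarrow> (real \<Rightarrow> real) \<Rightarrow> (real \<Rightarrow> real) \<Rightarrow>
    (real \<times> real \<Rightarrow> real) \<Rightarrow> (real \<times> real \<Rightarrow> real) \<Rightarrow> real \<times> real \<Rightarrow> real^3" where
  "cusp_map A B c0 c1 K2 K3 = (\<lambda>(u, v). vector [u, A u + v^2,
     B u + v^2 * c0 u + v^3 * c1 u + v^4 * K2 (u, v) + v^5 * K3 (u, v)])"

locale cusp_form =
  fixes S :: "(real \<times> real) set" and I :: "real set"
    and A B c0 c1 :: "real \<Rightarrow> real" and K2 K3 :: "real \<times> real \<Rightarrow> real"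
  assumes open_S': "open S" and open_I: "open I" and fst_S: "fst ` S \<subseteq> I"
    and smooth_A: "smooth_on I A" and smooth_B: "smooth_on I B"
    and smooth_c0: "smooth_on I c0" and smooth_c1: "smooth_on I c1"
    and smooth_K2: "smooth_on S K2" and smooth_K3: "smooth_on S K3"
begin

abbreviation h :: "real \<times> real \<Rightarrow> real^3" where "h \<equiv> cusp_map A B c0 c1 K2 K3"

text \<open>Powers of \<open>v\<close> are nested binary products, so that the equations
  \<open>D_mult\<close> rewrite them literally.\<close>

abbreviation v2 :: "real \<times> real \<Rightarrow> real" where "v2 \<equiv> \<lambda>x. snd x * snd x"
abbreviation v3 :: "real \<times> real \<Rightarrow> real" where "v3 \<equiv> \<lambda>x. snd x * v2 x"
abbreviation v4 :: "real \<times> real \<Rightarrow> real" where "v4 \<equiv> \<lambda>x. v2 x * v2 x"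
abbreviation v5 :: "real \<times> real \<Rightarrow> real" where "v5 \<equiv> \<lambda>x. snd x * v4 x"

lemma h_components:
  "(\<lambda>x. h x $ 1) = fst"
  "(\<lambda>x. h x $ 2) = (\<lambda>x. A (fst x) + v2 x)"
  "(\<lambda>x. h x $ 3) = (\<lambda>x. B (fst x) + v2 x * c0 (fst x) + v3 x * c1 (fst x) + v4 x * K2 x + v5 x * K3 x)"
  by (auto simp: cusp_map_def fun_eq_iff vector_3 eval_nat_numeral)

lemma smooth_v:
  "smooth_on S snd" "smooth_on S v2" "smooth_on S v3" "smooth_on S v4" "smooth_on S v5"
proof -
  show 1: "smooth_on S snd" by (rule smooth_on_snd[OF open_S'])
  show 2: "smooth_on S v2" by (rule smooth_on_mult[OF open_S' 1 1])
  show "smooth_on S v3" by (rule smooth_on_mult[OF open_S' 1 2])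
  show 4: "smooth_on S v4" by (rule smooth_on_mult[OF open_S' 2 2])
  show "smooth_on S v5" by (rule smooth_on_mult[OF open_S' 1 4])
qed

lemma smooth_fst:
  "smooth_on I \<phi> \<Longrightarrow> smooth_on S (\<lambda>x. \<phi> (fst x))"
  by (rule smooth_on_compose[OF open_S' open_I smooth_on_fst[OF open_S'] _ fst_S])

lemma smooth_terms:
  "smooth_on S (\<lambda>x. v2 x * c0 (fst x))" "smooth_on S (\<lambda>x. v3 x * c1 (fst x))"
  "smooth_on S (\<lambda>x. v4 x * K2 x)" "smooth_on S (\<lambda>x. v5 x * K3 x)"
  by (intro smooth_on_mult[OF open_S'] smooth_v smooth_fst smooth_c0 smooth_c1 smooth_K2 smooth_K3)+

text \<open>\<open>D_add\<close> is applied from the outermost summand inwards and needs each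
  remaining partial sum to be smooth.\<close>

lemma smooth_partial_sums:
  "smooth_on S (\<lambda>x. B (fst x) + v2 x * c0 (fst x))"
  "smooth_on S (\<lambda>x. B (fst x) + v2 x * c0 (fst x) + v3 x * c1 (fst x))"
  "smooth_on S (\<lambda>x. B (fst x) + v2 x * c0 (fst x) + v3 x * c1 (fst x) + v4 x * K2 x)"
  "smooth_on S (\<lambda>x. B (fst x) + v2 x * c0 (fst x) + v3 x * c1 (fst x) + v4 x * K2 x + v5 x * K3 x)"
proof -
  note add = smooth_on_add[OF open_S']
  show 1: "smooth_on S (\<lambda>x. B (fst x) + v2 x * c0 (fst x))"
    by (rule add[OF smooth_fst[OF smooth_B] smooth_terms(1)])
  show 2: "smooth_on S (\<lambda>x. B (fst x) + v2 x * c0 (fst x) + v3 x * c1 (fst x))"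
    by (rule add[OF 1 smooth_terms(2)])
  show 3: "smooth_on S (\<lambda>x. B (fst x) + v2 x * c0 (fst x) + v3 x * c1 (fst x) + v4 x * K2 x)"
    by (rule add[OF 2 smooth_terms(3)])
  show "smooth_on S (\<lambda>x. B (fst x) + v2 x * c0 (fst x) + v3 x * c1 (fst x) + v4 x * K2 x + v5 x * K3 x)"
    by (rule add[OF 3 smooth_terms(4)])
qed

lemma smooth_h_component: "smooth_on S (\<lambda>x. h x $ i)"
proof -
  have "smooth_on S (\<lambda>x. h x $ 1)" "smooth_on S (\<lambda>x. h x $ 2)" "smooth_on S (\<lambda>x. h x $ 3)"
    unfolding h_components
    by (rule smooth_on_fst[OF open_S'], rule smooth_on_add[OF open_S' smooth_fst[OF smooth_A] smooth_v(2)],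
      rule smooth_partial_sums(4))
  then show ?thesis using exhaust_3[of i] by metis
qed

lemma smooth_h: "smooth_on S h"
proof -
  have "smooth_on S (\<lambda>x. (h x $ 1) *\<^sub>R axis 1 1 + (h x $ 2) *\<^sub>R axis 2 1 + (h x $ 3) *\<^sub>R (axis 3 1 :: real^3))"
    by (intro smooth_on_add[OF open_S'] smooth_on_scaleR[OF open_S'] smooth_h_component smooth_on_const)
  moreover have "(\<lambda>x. (h x $ 1) *\<^sub>R axis 1 1 + (h x $ 2) *\<^sub>R axis 2 1 + (h x $ 3) *\<^sub>R (axis 3 1 :: real^3)) = h"
    by (auto simp: fun_eq_iff vec_eq_iff forall_3 axis_def)
  ultimately show ?thesis by simp
qed

end

section \<open>Jets of the normal form along a vector field\<close>

locale cusp_field = cusp_form + smooth_field S X for X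
begin

lemma D_h:
  assumes "x \<in> S"
  shows "D k h x = vector [D k fst x, D k (\<lambda>x. A (fst x)) x + D k v2 x,
    D k (\<lambda>x. B (fst x)) x + D k (\<lambda>x. v2 x * c0 (fst x)) x + D k (\<lambda>x. v3 x * c1 (fst x)) x
      + D k (\<lambda>x. v4 x * K2 x) x + D k (\<lambda>x. v5 x * K3 x) x]"
proof -
  have c: "D k h x $ i = D k (\<lambda>x. h x $ i) x" for i
    using D_linear[OF bounded_linear_vec_nth smooth_h assms, of k i] by simp
  have "D k (\<lambda>x. B (fst x) + v2 x * c0 (fst x) + v3 x * c1 (fst x) + v4 x * K2 x + v5 x * K3 x) x
    = D k (\<lambda>x. B (fst x)) x + D k (\<lambda>x. v2 x * c0 (fst x)) x + D k (\<lambda>x. v3 x * c1 (fst x)) x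
      + D k (\<lambda>x. v4 x * K2 x) x + D k (\<lambda>x. v5 x * K3 x) x"
    unfolding D_add[OF smooth_partial_sums(3) smooth_terms(4) assms]
      D_add[OF smooth_partial_sums(2) smooth_terms(3) assms]
      D_add[OF smooth_partial_sums(1) smooth_terms(2) assms]
      D_add[OF smooth_fst[OF smooth_B] smooth_terms(1) assms] by simp
  moreover have "D k (\<lambda>x. A (fst x) + v2 x) x = D k (\<lambda>x. A (fst x)) x + D k v2 x"
    by (rule D_add[OF smooth_fst[OF smooth_A] smooth_v(2) assms])
  ultimately show ?thesis
    unfolding vec_eq_iff forall_3 c h_components by (simp add: vector_3)
qed

text \<open>The field may still have a horizontal component here. This serves to read off
  \<open>D 1 fst x = 0\<close> from the vanishing of \<open>D 1 h x\<close> and, with the constant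
  field \<open>(1, 0)\<close>, to compute \<open>partial_u\<close>.\<close>

lemma D_h_1:
  assumes "x \<in> S" "snd x = 0"
  shows "D 1 h x = vector [fst (X x), deriv A (fst x) * fst (X x), deriv B (fst x) * fst (X x)]"
proof -
  note m = D_mult(1)[OF _ _ assms(1)]
  have "D 1 (\<lambda>x. \<phi> (fst x)) x = deriv \<phi> (fst x) * fst (X x)" if "smooth_on I \<phi>" for \<phi> :: "real \<Rightarrow> real"
    using dirderiv_compose_fst[OF open_I fst_S that assms(1)] by (simp add: iter_dirderiv_def)
  then show ?thesis
    using assms(2)
    unfolding D_h[OF assms(1)] m[OF smooth_v(2) smooth_fst[OF smooth_c0]]
      m[OF smooth_v(3) smooth_fst[OF smooth_c1]] m[OF smooth_v(4) smooth_K2] m[OF smooth_v(5) smooth_K3]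
      m[OF smooth_v(1) smooth_v(1)] m[OF smooth_v(1) smooth_v(2)] m[OF smooth_v(2) smooth_v(2)]
      m[OF smooth_v(1) smooth_v(4)]
    by (simp add: smooth_A smooth_B D_fst_1 del: One_nat_def)
qed

context
  fixes x assumes x: "x \<in> S" "snd x = 0" "D 1 fst x = 0"
begin

lemma D_v2:
  "D 1 v2 x = 0" "D 2 v2 x = 2 * (D 1 snd x)^2" "D 3 v2 x = 6 * D 1 snd x * D 2 snd x"
  "D 4 v2 x = 8 * D 1 snd x * D 3 snd x + 6 * (D 2 snd x)^2"
  "D 5 v2 x = 10 * D 1 snd x * D 4 snd x + 20 * D 2 snd x * D 3 snd x"
  unfolding D_mult[OF smooth_v(1) smooth_v(1) x(1)] using x(2)
  by (simp_all add: power2_eq_square)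

text \<open>Order four suffices: the fifth jet of \<open>v3\<close> enters \<open>D 5 h\<close> only
  multiplied by \<open>c1\<close>, which is zero at the points considered in
  \<open>D_h_high\<close>.\<close>

lemma D_v3:
  "D 1 v3 x = 0" "D 2 v3 x = 0" "D 3 v3 x = 6 * (D 1 snd x)^3"
  "D 4 v3 x = 36 * (D 1 snd x)^2 * D 2 snd x"
  unfolding D_mult[OF smooth_v(1) smooth_v(2) x(1)] D_v2 using x(2)
  by (simp_all add: eval_nat_numeral)

lemma D_v4:
  "D 1 v4 x = 0" "D 2 v4 x = 0" "D 3 v4 x = 0" "D 4 v4 x = 24 * (D 1 snd x)^4"
  "D 5 v4 x = 240 * (D 1 snd x)^3 * D 2 snd x"
  unfolding D_mult[OF smooth_v(2) smooth_v(2) x(1)] D_v2 using x(2)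
  by (simp_all add: eval_nat_numeral)

lemma D_v5:
  "D 1 v5 x = 0" "D 2 v5 x = 0" "D 3 v5 x = 0" "D 4 v5 x = 0" "D 5 v5 x = 120 * (D 1 snd x)^5"
  unfolding D_mult[OF smooth_v(1) smooth_v(4) x(1)] D_v4 using x(2)
  by (simp_all add: eval_nat_numeral)

lemmas mult_expand = D_mult[OF smooth_v(2) smooth_fst[OF smooth_c0] x(1)]
  D_mult[OF smooth_v(3) smooth_fst[OF smooth_c1] x(1)]
  D_mult[OF smooth_v(4) smooth_K2 x(1)] D_mult[OF smooth_v(5) smooth_K3 x(1)]

lemmas fst_expand = D_compose_fst[OF open_I fst_S smooth_A x(1,3)]
  D_compose_fst[OF open_I fst_S smooth_B x(1,3)] D_compose_fst[OF open_I fst_S smooth_c0 x(1,3)]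
  D_compose_fst[OF open_I fst_S smooth_c1 x(1,3)]

lemma D_h_low:
  "D 1 h x = 0"
  "D 2 h x = vector [D 2 fst x, deriv A (fst x) * D 2 fst x + 2 * (D 1 snd x)^2,
     deriv B (fst x) * D 2 fst x + 2 * c0 (fst x) * (D 1 snd x)^2]"
  "D 3 h x = vector [D 3 fst x, deriv A (fst x) * D 3 fst x + 6 * D 1 snd x * D 2 snd x,
     deriv B (fst x) * D 3 fst x + 6 * c0 (fst x) * D 1 snd x * D 2 snd x
       + 6 * c1 (fst x) * (D 1 snd x)^3]"
  unfolding D_h[OF x(1)] mult_expand D_v2 D_v3 D_v4 D_v5 fst_expand vec_eq_iff forall_3
  using x(2,3) by (simp_all add: vector_3)

text \<open>The equation for \<open>c1\<close> marks the cuspidal cross cap and kills all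
  undifferentiated \<open>c1\<close> terms. The one for \<open>K2\<close>, available when
  \<open>K2\<close> is even in \<open>v\<close> and the field is vertical, kills the term
  \<open>5 * D 4 v4 x * D 1 K2 x\<close> of order five.\<close>

lemma D_h_high:
  assumes "c1 (fst x) = 0" "D 1 K2 x = 0"
  shows "D 4 h x = vector [D 4 fst x,
      deriv A (fst x) * D 4 fst x + 3 * deriv (deriv A) (fst x) * (D 2 fst x)^2
        + 8 * D 1 snd x * D 3 snd x + 6 * (D 2 snd x)^2,
      deriv B (fst x) * D 4 fst x + 3 * deriv (deriv B) (fst x) * (D 2 fst x)^2
        + c0 (fst x) * (8 * D 1 snd x * D 3 snd x + 6 * (D 2 snd x)^2)
        + 12 * (D 1 snd x)^2 * deriv c0 (fst x) * D 2 fst x + 24 * (D 1 snd x)^4 * K2 x]"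
    and "D 5 h x = vector [D 5 fst x,
      deriv A (fst x) * D 5 fst x + 10 * deriv (deriv A) (fst x) * D 2 fst x * D 3 fst x
        + 10 * D 1 snd x * D 4 snd x + 20 * D 2 snd x * D 3 snd x,
      deriv B (fst x) * D 5 fst x + 10 * deriv (deriv B) (fst x) * D 2 fst x * D 3 fst x
        + c0 (fst x) * (10 * D 1 snd x * D 4 snd x + 20 * D 2 snd x * D 3 snd x)
        + 20 * (D 1 snd x)^2 * deriv c0 (fst x) * D 3 fst x
        + 60 * D 1 snd x * D 2 snd x * deriv c0 (fst x) * D 2 fst x
        + 60 * (D 1 snd x)^3 * deriv c1 (fst x) * D 2 fst x
        + 240 * (D 1 snd x)^3 * D 2 snd x * K2 x + 120 * (D 1 snd x)^5 * K3 x]"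
  unfolding D_h[OF x(1)] mult_expand D_v2 D_v3 D_v4 D_v5 fst_expand vec_eq_iff forall_3
  using x(2,3) assms by (simp_all add: vector_3 algebra_simps)

end

end

lemma (in cusp_form) partial_u_h:
  assumes "x \<in> S" "snd x = 0"
  shows "partial_u h x = vector [1, deriv A (fst x), deriv B (fst x)]"
proof -
  \<comment> \<open>\<open>partial_u\<close> is the directional derivative along the constant field
    \<open>(1, 0)\<close>, so \<open>D_h_1\<close> already contains it.\<close>
  interpret c: cusp_field S I A B c0 c1 K2 K3 "\<lambda>_. (1, 0)"
    by unfold_locales (rule open_S', rule smooth_on_const)
  show ?thesis
    using c.D_h_1[OF assms] by (simp add: iter_dirderiv_def dirderiv_def partial_u_def)
qed

section \<open>Closed forms of the two invariants\<close>

definition cusp_xi :: "real \<Rightarrow> real \<Rightarrow> real \<Rightarrow> real" where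
  "cusp_xi a b c = - 2 * (a + c * b) / (1 + a^2 + b^2)"

text \<open>Length of the cross product in both denominators after removal of the factor
  \<open>y1^2\<close>, with \<open>y1\<close> the vertical component of the field; see
  \<open>norm_cross_cusp\<close>.\<close>

definition cusp_N :: "real \<Rightarrow> real \<Rightarrow> real \<Rightarrow> real" where
  "cusp_N a b c = 2 * sqrt (1 + c^2 + (c * a - b)^2)"

text \<open>Here \<open>a\<close>, \<open>b\<close> and \<open>a'\<close>, \<open>b'\<close> are
  first and second derivatives of \<open>A\<close> and \<open>B\<close>, \<open>c\<close> and
  \<open>c'\<close> are the value and derivative of \<open>c0\<close>, and \<open>k\<close> is the
  value of \<open>K2\<close>. The common factor \<open>y1^6\<close> has been cancelled.\<close>

definition cusp_bias :: "real \<Rightarrow> real \<Rightarrow> real \<Rightarrow> real \<Rightarrow> real \<Rightarrow> real \<Rightarrow> real \<Rightarrow> real" where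
  "cusp_bias a b a' b' c c' k =
     (1 + a^2 + b^2) * (6 * (b' - c * a') * (cusp_xi a b c)^2 + 24 * c' * cusp_xi a b c + 48 * k)
     / cusp_N a b c ^ 3"

definition cusp_sec :: "real \<Rightarrow> real \<Rightarrow> real \<Rightarrow> real \<Rightarrow> real \<Rightarrow> real" where
  "cusp_sec a b c c1' k = sqrt (1 + a^2 + b^2) powr (5/2) * (720 * k + 360 * c1' * cusp_xi a b c)
     / cusp_N a b c powr (7/2)"

lemma det3_vector:
  "det3 (vector [a1, a2, a3]) (vector [b1, b2, b3]) (vector [x1, x2, x3])
   = a1 * (b2 * x3 - b3 * x2) - a2 * (b1 * x3 - b3 * x1) + a3 * (b1 * x2 - b2 * x1)"
  by (simp add: det3_def det_3 vector_3 algebra_simps)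

lemma norm_vector_3: "norm (vector [a, b, c] :: real^3) = sqrt (a^2 + b^2 + c^2)"
  by (simp add: norm_vec_def L2_set_def sum_3 vector_3)

lemma inner_vector_3:
  "(vector [a1, a2, a3] :: real^3) \<bullet> vector [b1, b2, b3] = a1 * b1 + a2 * b2 + a3 * b3"
  by (simp add: inner_vec_def sum_3 vector_3)

lemma scaleR_vector_3: "r *\<^sub>R (vector [a, b, c] :: real^3) = vector [r * a, r * b, r * c]"
  by (simp add: vec_eq_iff forall_3 vector_3)

lemma diff_vector_3:
  "(vector [a1, a2, a3] :: real^3) - vector [b1, b2, b3] = vector [a1 - b1, a2 - b2, a3 - b3]"
  by (simp add: vec_eq_iff forall_3 vector_3)

lemma vector_3_eq_iff:
  "(vector [a1, a2, a3] :: real^3) = vector [b1, b2, b3] \<longleftrightarrow> a1 = b1 \<and> a2 = b2 \<and> a3 = b3"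
  by (simp add: vec_eq_iff forall_3 vector_3)

text \<open>The second vector is \<open>x2\<close> times the first plus \<open>2 * y^2\<close> times
  \<open>(0, 1, c)\<close>, so \<open>x2\<close> drops out of the cross product.\<close>

lemma norm_cross_cusp:
  "norm (cross3 (vector [1, a, b]) (vector [x2, a * x2 + 2 * y^2, b * x2 + 2 * c * y^2]))
   = y^2 * cusp_N a b c"
proof -
  have "norm (cross3 (vector [1, a, b]) (vector [x2, a * x2 + 2 * y^2, b * x2 + 2 * c * y^2]))
    = sqrt ((2 * y^2)^2 * (1 + c^2 + (c * a - b)^2))"
    unfolding cross3_def
    by (simp add: vector_3 norm_vector_3) (simp add: eval_nat_numeral algebra_simps)
  then show ?thesis
    unfolding real_sqrt_mult real_sqrt_abs cusp_N_def by simp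
qed

lemma cusp_N_pos: "cusp_N a b c > 0"
  unfolding cusp_N_def by (simp add: add_pos_nonneg)

lemma cusp_form_subset:
  assumes "cusp_form S I A B c0 c1 K2 K3" "open T" "T \<subseteq> S"
  shows "cusp_form T I A B c0 c1 K2 K3"
  using assms smooth_on_subset unfolding cusp_form_def by blast

context cusp_form
begin

text \<open>Admissibility leaves \<open>l\<close>, \<open>y1\<close> and the higher jets free.
  Higher jets contribute only vectors in the plane of \<open>h_u\<close> and \<open>eta^2 h\<close>,
  \<open>l\<close> cancels in the combination of \<open>eta^5 h\<close> and \<open>eta^4 h\<close>,
  and \<open>y1\<close> cancels by homogeneity. Hence the values do not depend on the field
  chosen.\<close>

lemma invariants_of_admissible:
  assumes adm: "admissible_field h (u0, 0) eta l" and p: "(u0, 0) \<in> S" and c1: "c1 u0 = 0"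
    and K2: "frechet_derivative K2 (at (u0, 0)) (0, 1) = 0"
  shows "bias h (u0, 0) eta = cusp_bias (deriv A u0) (deriv B u0) (deriv (deriv A) u0)
      (deriv (deriv B) u0) (c0 u0) (deriv c0 u0) (K2 (u0, 0))"
    and "sec_cusp_curv h (u0, 0) eta l = cusp_sec (deriv A u0) (deriv B u0) (c0 u0)
      (deriv c1 u0) (K3 (u0, 0))"
proof -
  obtain e where e: "e > 0" "smooth_on (ball (u0, 0) e) eta"
    and along: "\<And>t. \<bar>t - u0\<bar> < e \<Longrightarrow> iter_dirderiv eta 1 h (t, 0) = 0 \<and>
           partial_u h (t, 0) \<bullet> iter_dirderiv eta 2 h (t, 0) = 0 \<and>
           partial_u h (t, 0) \<bullet> iter_dirderiv eta 3 h (t, 0) = 0"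
    and y1: "snd (eta (u0, 0)) > 0"
    and l: "iter_dirderiv eta 3 h (u0, 0) = l *\<^sub>R iter_dirderiv eta 2 h (u0, 0)"
    using adm unfolding admissible_field_def by auto
  \<comment> \<open>The derivative rules need the map and the field smooth on one common open
    set.\<close>
  define T where "T = S \<inter> ball (u0, 0) e"
  have T: "open T" "T \<subseteq> S" "(u0, 0) \<in> T"
    using e(1) p open_S' by (auto simp: T_def)
  interpret c: cusp_field T I A B c0 c1 K2 K3 eta
    unfolding cusp_field_def smooth_field_def
    using cusp_form_subset[OF cusp_form_axioms T(1,2)] T(1) smooth_on_subset[OF e(2), of T]
    by (auto simp: T_def)
  \<comment> \<open>The first component of \<open>h\<close> is \<open>u\<close>, so annihilation of
    \<open>h\<close> forces the field to be vertical at the point.\<close>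
  have "c.D 1 h (u0, 0) $ 1 = 0"
    using along[of u0] e(1) by simp
  then have x1: "c.D 1 fst (u0, 0) = 0"
    using c.D_h_1[OF T(3)] by (simp add: vector_3 c.D_fst_1 del: One_nat_def)
  note x = T(3) snd_conv[of u0 0] x1
  have "c.D 1 K2 (u0, 0) = 0"
  proof -
    interpret K: linear "frechet_derivative K2 (at (u0, 0))"
      using smooth_on_has_derivative[OF smooth_K2 open_S' p] has_derivative_linear by blast
    have "eta (u0, 0) = snd (eta (u0, 0)) *\<^sub>R (0, 1)"
      using x1 by (simp add: c.D_fst_1 prod_eq_iff del: One_nat_def)
    then have "frechet_derivative K2 (at (u0, 0)) (eta (u0, 0))
        = snd (eta (u0, 0)) *\<^sub>R frechet_derivative K2 (at (u0, 0)) (0, 1)"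
      using K.scale by metis
    then show ?thesis using K2 by (simp add: iter_dirderiv_def dirderiv_def)
  qed
  note high = c.D_h_high[OF x, unfolded fst_conv, OF c1 this]
  note low = c.D_h_low[OF x, unfolded fst_conv]
  define a b a' b' c c' k2 k3 c1' where "a = deriv A u0" "b = deriv B u0" "a' = deriv (deriv A) u0"
    "b' = deriv (deriv B) u0" "c = c0 u0" "c' = deriv c0 u0" "k2 = K2 (u0, 0)" "k3 = K3 (u0, 0)"
    "c1' = deriv c1 u0"
  note defs = this
  define x2 x3 x4 x5 where "x2 = c.D 2 fst (u0, 0)" "x3 = c.D 3 fst (u0, 0)"
    "x4 = c.D 4 fst (u0, 0)" "x5 = c.D 5 fst (u0, 0)"
  note xdefs = this
  define y1 y2 y3 y4 where "y1 = c.D 1 snd (u0, 0)" "y2 = c.D 2 snd (u0, 0)"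
    "y3 = c.D 3 snd (u0, 0)" "y4 = c.D 4 snd (u0, 0)"
  note ydefs = this
  define W \<xi> where "W = 1 + a^2 + b^2" and "\<xi> = cusp_xi a b c"
  have W: "W > 0" unfolding W_def by (simp add: add_pos_nonneg)
  have y1_pos: "y1 > 0"
    using y1 unfolding ydefs c.D_snd_1 .
  have hu: "partial_u h (u0, 0) = vector [1, a, b]"
    using partial_u_h[OF p] by (simp add: defs)
  have h2: "c.D 2 h (u0, 0) = vector [x2, a * x2 + 2 * y1^2, b * x2 + 2 * c * y1^2]"
    using low(2) unfolding defs xdefs ydefs .
  have h3: "c.D 3 h (u0, 0) = vector [x3, a * x3 + 6 * y1 * y2, b * x3 + 6 * c * y1 * y2]"
    using low(3) c1 unfolding defs xdefs ydefs by simp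
  have h4: "c.D 4 h (u0, 0) = vector [x4, a * x4 + 3 * a' * x2^2 + 8 * y1 * y3 + 6 * y2^2,
      b * x4 + 3 * b' * x2^2 + c * (8 * y1 * y3 + 6 * y2^2) + 12 * y1^2 * c' * x2 + 24 * y1^4 * k2]"
    using high(1) unfolding defs xdefs ydefs .
  have h5: "c.D 5 h (u0, 0) = vector [x5, a * x5 + 10 * a' * x2 * x3 + 10 * y1 * y4 + 20 * y2 * y3,
      b * x5 + 10 * b' * x2 * x3 + c * (10 * y1 * y4 + 20 * y2 * y3) + 20 * y1^2 * c' * x3
        + 60 * y1 * y2 * c' * x2 + 60 * y1^3 * c1' * x2 + 240 * y1^3 * y2 * k2 + 120 * y1^5 * k3]"
    using high(2) unfolding defs xdefs ydefs .
  \<comment> \<open>Orthogonality at order two is a linear equation for \<open>x2\<close> whose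
    coefficient \<open>W\<close> is positive.\<close>
  have "vector [1, a, b] \<bullet> (vector [x2, a * x2 + 2 * y1^2, b * x2 + 2 * c * y1^2] :: real^3) = 0"
    using along[of u0] e(1) unfolding hu h2 by simp
  then have "x2 * W = y1^2 * (- 2 * (a + c * b))"
    unfolding inner_vector_3 W_def by (simp add: algebra_simps power2_eq_square)
  then have x2: "x2 = y1^2 * \<xi>"
    using W unfolding \<xi>_def cusp_xi_def W_def[symmetric] by (simp add: field_simps)
  \<comment> \<open>The first component gives \<open>x3\<close>; subtracting \<open>a\<close> times
    it from the second isolates \<open>y2\<close>.\<close>
  have "x3 = l * x2" "a * x3 + 6 * y1 * y2 = l * (a * x2 + 2 * y1^2)"
    using l unfolding h2 h3 scaleR_vector_3 vector_3_eq_iff by auto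
  then have x3: "x3 = l * x2" and "y1 * (6 * y2) = y1 * (2 * l * y1)"
    by (auto simp: algebra_simps power2_eq_square)
  \<comment> \<open>With \<open>m = l / 3\<close> the polynomial identities below stay free of
    fractions.\<close>
  then obtain m where l3: "l = 3 * m" and y2: "y2 = m * y1"
    using y1_pos that[of "l / 3"] by simp
  have nhu: "norm (partial_u h (u0, 0)) = sqrt W"
    unfolding hu norm_vector_3 W_def by simp
  have nc: "norm (cross3 (partial_u h (u0, 0)) (c.D 2 h (u0, 0))) = y1^2 * cusp_N a b c"
    unfolding hu h2 by (rule norm_cross_cusp)
  \<comment> \<open>Modulo the plane spanned by \<open>h_u\<close> and \<open>(0, 1, c)\<close>,
    which is that of \<open>h_u\<close> and \<open>eta^2 h\<close>, the jets \<open>x4\<close>,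
    \<open>y2\<close> and \<open>y3\<close> disappear from \<open>eta^4 h\<close>.\<close>
  have d4: "det3 (partial_u h (u0, 0)) (c.D 2 h (u0, 0)) (c.D 4 h (u0, 0))
      = y1^6 * (6 * (b' - c * a') * \<xi>^2 + 24 * c' * \<xi> + 48 * k2)"
    unfolding hu h2 h4 det3_vector x2 by (simp add: algebra_simps eval_nat_numeral)
  \<comment> \<open>Through \<open>x3\<close> and \<open>y2\<close> the fifth derivative acquires
    terms with factor \<open>l\<close>. The weights 3 and 10 make those with \<open>a'\<close>,
    \<open>b'\<close>, \<open>c'\<close> and \<open>k2\<close> cancel; only \<open>c1'\<close> and
    \<open>k3\<close> survive.\<close>
  have d5: "det3 (partial_u h (u0, 0)) (c.D 2 h (u0, 0))
        (3 *\<^sub>R c.D 5 h (u0, 0) - (10 * l) *\<^sub>R c.D 4 h (u0, 0))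
      = y1^7 * (720 * k3 + 360 * c1' * \<xi>)"
    unfolding hu h2 h4 h5 scaleR_vector_3 diff_vector_3 det3_vector x3 x2 y2 l3
    by (simp add: algebra_simps eval_nat_numeral)
  have "bias h (u0, 0) eta = W * (y1^6 * (6 * (b' - c * a') * \<xi>^2 + 24 * c' * \<xi> + 48 * k2))
      / (y1^2 * cusp_N a b c)^3"
    unfolding bias_def nc nhu d4 using W by simp
  also have "\<dots> = cusp_bias a b a' b' c c' k2"
    unfolding cusp_bias_def W_def[symmetric] \<xi>_def[symmetric] power_mult_distrib
    using y1_pos cusp_N_pos[of a b c] by (simp add: field_simps)
  finally show "bias h (u0, 0) eta = cusp_bias (deriv A u0) (deriv B u0) (deriv (deriv A) u0)
      (deriv (deriv B) u0) (c0 u0) (deriv c0 u0) (K2 (u0, 0))"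
    unfolding defs .
  \<comment> \<open>An odd power appears, so the orientation \<open>y1 > 0\<close> matters:
    otherwise the sign of the curvature would flip.\<close>
  have "(y1^2) powr (7/2) = y1^7"
    using y1_pos powr_powr[of y1 2 "7/2"] powr_realpow[of y1 7] powr_realpow[of y1 2] by simp
  then have pw: "(y1^2 * cusp_N a b c) powr (7/2) = y1^7 * cusp_N a b c powr (7/2)"
    using cusp_N_pos[of a b c] by (simp add: powr_mult)
  have "sec_cusp_curv h (u0, 0) eta l = sqrt W powr (5/2) * (y1^7 * (720 * k3 + 360 * c1' * \<xi>))
      / (y1^7 * cusp_N a b c powr (7/2))"
    unfolding sec_cusp_curv_def nc nhu d5 pw by simp
  also have "\<dots> = cusp_sec a b c c1' k3"
    unfolding cusp_sec_def W_def[symmetric] \<xi>_def[symmetric] using y1_pos by simp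
  finally show "sec_cusp_curv h (u0, 0) eta l = cusp_sec (deriv A u0) (deriv B u0) (c0 u0)
      (deriv c1 u0) (K3 (u0, 0))"
    unfolding defs .
qed

text \<open>The coefficients are forced by the two orthogonality conditions; scaling the field by
  \<open>|h\<^sub>u|\<^sup>2\<close> avoids denominators.\<close>
lemma admissible_field_exists:
  assumes p: "(u0, 0) \<in> S" and c1: "c1 u0 = 0"
  shows "\<exists>eta l. admissible_field h (u0, 0) eta l"
proof -
  define W where "W = (\<lambda>u. 1 + deriv A u ^ 2 + deriv B u ^ 2)"
  \<comment> \<open>On the axis this field has \<open>y1 = W\<close>, \<open>y2 = 0\<close> and
    \<open>x2 = W * \<alpha>\<close>, so \<open>\<alpha>\<close> solves
    \<open>x2 * W = - 2 * y1^2 * (A' + c0 * B')\<close>, the orthogonality at order two.\<close>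
  define \<alpha> where "\<alpha> = (\<lambda>u. - 2 * (deriv A u + c0 u * deriv B u))"
  \<comment> \<open>With \<open>x3 = 2 * W^2 * \<beta>\<close>, orthogonality at order three reads
    \<open>x3 * W + 6 * c1 * y1^3 * B' = 0\<close>.\<close>
  define \<beta> where "\<beta> = (\<lambda>u. - 3 * c1 u * deriv B u)"
  define eta where "eta = (\<lambda>x :: real \<times> real. (snd x * \<alpha> (fst x) + v2 x * \<beta> (fst x), W (fst x)))"
  note dA = smooth_on_deriv[OF open_I smooth_A] and dB = smooth_on_deriv[OF open_I smooth_B]
  have W: "smooth_on I W" and \<alpha>: "smooth_on I \<alpha>" and \<beta>: "smooth_on I \<beta>"
    unfolding W_def \<alpha>_def \<beta>_def
    by (intro smooth_on_add[OF open_I] smooth_on_mult[OF open_I] smooth_on_power[OF open_I]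
      smooth_on_const dA dB smooth_c0 smooth_c1)+
  have t1: "smooth_on S (\<lambda>x. snd x * \<alpha> (fst x))" and t2: "smooth_on S (\<lambda>x. v2 x * \<beta> (fst x))"
    by (intro smooth_on_mult[OF open_S'] smooth_v smooth_fst \<alpha> \<beta>)+
  have eta: "smooth_on S eta"
    unfolding eta_def by (intro smooth_on_Pair[OF open_S'] smooth_on_add[OF open_S'] t1 t2 smooth_fst W)
  interpret c: cusp_field S I A B c0 c1 K2 K3 eta
    by unfold_locales (rule open_S', rule eta)
  have W_pos: "W u > 0" for u by (simp add: W_def add_pos_nonneg)
  have main: "c.D 1 h (t, 0) = 0" "partial_u h (t, 0) \<bullet> c.D 2 h (t, 0) = 0"
    "partial_u h (t, 0) \<bullet> c.D 3 h (t, 0) = 0" "c1 t = 0 \<Longrightarrow> c.D 3 h (t, 0) = 0"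
    if t: "(t, 0) \<in> S" for t
  proof -
    have x1: "c.D 1 fst (t, 0) = 0" unfolding c.D_fst_1 by (simp add: eta_def)
    note x = t snd_conv[of t 0] x1
    have fst_eta: "(\<lambda>x. fst (eta x)) = (\<lambda>x. snd x * \<alpha> (fst x) + v2 x * \<beta> (fst x))"
      and snd_eta: "(\<lambda>x. snd (eta x)) = (\<lambda>x. W (fst x))"
      by (auto simp: eta_def)
    have y1: "c.D 1 snd (t, 0) = W t"
      unfolding c.D_snd_1 by (simp add: eta_def)
    have y2: "c.D 2 snd (t, 0) = 0"
      using c.D_snd_Suc[of 1] c.D_compose_fst(1)[OF open_I fst_S W t x1]
      by (simp add: snd_eta numeral_2_eq_2)
    note m\<alpha> = c.D_mult[OF smooth_v(1) smooth_fst[OF \<alpha>] t]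
      and m\<beta> = c.D_mult[OF smooth_v(2) smooth_fst[OF \<beta>] t]
      and f\<alpha> = c.D_compose_fst[OF open_I fst_S \<alpha> t x1]
      and f\<beta> = c.D_compose_fst[OF open_I fst_S \<beta> t x1]
    have "c.D 2 fst (t, 0) = c.D 1 (\<lambda>x. snd x * \<alpha> (fst x) + v2 x * \<beta> (fst x)) (t, 0)"
      using c.D_fst_Suc[of 1] by (simp add: fst_eta numeral_2_eq_2)
    then have x2: "c.D 2 fst (t, 0) = W t * \<alpha> t"
      unfolding c.D_add[OF t1 t2 t] m\<alpha> m\<beta> f\<alpha> f\<beta> c.D_v2[OF x] y1 by simp
    have "c.D 3 fst (t, 0) = c.D 2 (\<lambda>x. snd x * \<alpha> (fst x) + v2 x * \<beta> (fst x)) (t, 0)"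
      using c.D_fst_Suc[of 2] by (simp add: fst_eta numeral_3_eq_3 numeral_2_eq_2)
    then have x3: "c.D 3 fst (t, 0) = 2 * (W t)^2 * \<beta> t"
      unfolding c.D_add[OF t1 t2 t] m\<alpha> m\<beta> f\<alpha> f\<beta> c.D_v2[OF x] y1 y2 by simp
    note low = c.D_h_low[OF x, unfolded x2 x3 y1 y2 fst_conv]
    have hu: "partial_u h (t, 0) = vector [1, deriv A t, deriv B t]"
      using partial_u_h[OF t] by simp
    show "c.D 1 h (t, 0) = 0" by (rule low(1))
    show "partial_u h (t, 0) \<bullet> c.D 2 h (t, 0) = 0"
      unfolding hu low(2) inner_vector_3 by (simp add: \<alpha>_def W_def algebra_simps power2_eq_square)
    show "partial_u h (t, 0) \<bullet> c.D 3 h (t, 0) = 0"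
      unfolding hu low(3) inner_vector_3
      by (simp add: \<beta>_def W_def algebra_simps eval_nat_numeral)
    show "c.D 3 h (t, 0) = 0" if "c1 t = 0"
      unfolding low(3) using that by (simp add: \<beta>_def vec_eq_iff forall_3 vector_3)
  qed
  obtain e where e: "e > 0" "ball (u0, 0) e \<subseteq> S"
    using p open_S' open_contains_ball by blast
  have "(t, 0) \<in> S" if "\<bar>t - u0\<bar> < e" for t
    using e(2) that by (auto simp: dist_Pair_Pair dist_real_def)
  \<comment> \<open>At a zero of \<open>c1\<close> also \<open>\<beta>\<close> vanishes, hence the
    whole third derivative of \<open>h\<close>, and \<open>l = 0\<close> serves.\<close>
  then have "admissible_field h (u0, 0) eta 0"
    unfolding admissible_field_def
    using main smooth_on_subset[OF eta e(2)] e W_pos p c1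
    by (auto simp: eta_def zero_prod_def less_imp_neq[OF W_pos, symmetric] intro!: exI[of _ e])
  then show ?thesis by blast
qed

end

section \<open>First-order expansions\<close>

text \<open>The filter \<open>at 0\<close> leaves out the origin, matching a claim about nonzero
  \<open>t\<close> only.\<close>

definition lin_exp :: "(real \<Rightarrow> real) \<Rightarrow> real \<Rightarrow> real \<Rightarrow> bool" where
  "lin_exp f a b \<longleftrightarrow> (\<lambda>t. f t - (a + b * t)) \<in> O[at 0](\<lambda>t. t^2)"

lemma linear_bigo_1: "(\<lambda>t. a + b * t :: real) \<in> O[at 0](\<lambda>_. 1)"
proof -
  have "((\<lambda>t. a + b * t) \<longlongrightarrow> a + b * 0) (at 0)"
    by (intro tendsto_intros)
  then show ?thesis by (intro bigoI_tendsto[of _ _ a]) auto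
qed

lemma lin_exp_bigo_1:
  assumes "lin_exp f a b"
  shows "f \<in> O[at 0](\<lambda>_. 1)"
proof -
  have "((\<lambda>t::real. t^2) \<longlongrightarrow> 0^2) (at 0)"
    by (intro tendsto_intros)
  then have "(\<lambda>t::real. t^2) \<in> O[at 0](\<lambda>_. 1)" by (intro bigoI_tendsto[of _ _ 0]) auto
  then have "(\<lambda>t. f t - (a + b * t)) \<in> O[at 0](\<lambda>_. 1)"
    using assms landau_o.big_trans unfolding lin_exp_def by blast
  from sum_in_bigo(1)[OF this linear_bigo_1[of a b]] show ?thesis by simp
qed

lemma lin_exp_const: "lin_exp (\<lambda>_. c) c 0"
  by (simp add: lin_exp_def)

lemma lin_exp_add:
  assumes "lin_exp f a b" "lin_exp g c d"
  shows "lin_exp (\<lambda>t. f t + g t) (a + c) (b + d)"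
  using sum_in_bigo(1)[OF assms[unfolded lin_exp_def]]
  unfolding lin_exp_def by (simp add: algebra_simps)

lemma lin_exp_diff:
  assumes "lin_exp f a b" "lin_exp g c d"
  shows "lin_exp (\<lambda>t. f t - g t) (a - c) (b - d)"
  using sum_in_bigo(2)[OF assms[unfolded lin_exp_def]]
  unfolding lin_exp_def by (simp add: algebra_simps)

lemma lin_exp_mult:
  assumes "lin_exp f a b" "lin_exp g c d"
  shows "lin_exp (\<lambda>t. f t * g t) (a * c) (a * d + b * c)"
proof -
  \<comment> \<open>Replacing one factor at a time by its linear part gives two remainders; the
    third is the quadratic term of the product of the linear parts.\<close>
  have 1: "(\<lambda>t. (f t - (a + b * t)) * g t) \<in> O[at 0](\<lambda>t. t^2 * 1)"
    using assms(1) lin_exp_bigo_1[OF assms(2)] unfolding lin_exp_def by (rule landau_o.big.mult)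
  have 2: "(\<lambda>t. (a + b * t) * (g t - (c + d * t))) \<in> O[at 0](\<lambda>t. 1 * t^2)"
    using linear_bigo_1 assms(2) unfolding lin_exp_def by (rule landau_o.big.mult)
  have 3: "(\<lambda>t. (b * d) * t^2) \<in> O[at 0](\<lambda>t. t^2)" by simp
  have "(\<lambda>t. (f t - (a + b * t)) * g t + (a + b * t) * (g t - (c + d * t)) + (b * d) * t^2)
      \<in> O[at 0](\<lambda>t. t^2)"
    using 1 2 3 by (intro sum_in_bigo) auto
  moreover have "(\<lambda>t. (f t - (a + b * t)) * g t + (a + b * t) * (g t - (c + d * t)) + (b * d) * t^2)
      = (\<lambda>t. f t * g t - (a * c + (a * d + b * c) * t))"
    by (auto simp: fun_eq_iff algebra_simps power2_eq_square)
  ultimately show ?thesis by (simp add: lin_exp_def)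
qed

lemma lin_exp_tendsto:
  assumes "lin_exp f a b"
  shows "(f \<longlongrightarrow> a) (at 0)"
proof -
  obtain C where C: "\<forall>\<^sub>F t in at 0. norm (f t - (a + b * t)) \<le> C * norm (t^2)"
    using assms unfolding lin_exp_def by (elim landau_o.bigE) blast
  have "((\<lambda>t::real. C * norm (t^2)) \<longlongrightarrow> C * norm ((0::real)^2)) (at 0)"
    by (intro tendsto_intros)
  then have "((\<lambda>t. f t - (a + b * t)) \<longlongrightarrow> 0) (at 0)"
    using Lim_null_comparison[OF C] by simp
  moreover have "((\<lambda>t. a + b * t) \<longlongrightarrow> a + b * 0) (at 0)"
    by (intro tendsto_intros)
  ultimately have "((\<lambda>t. (f t - (a + b * t)) + (a + b * t)) \<longlongrightarrow> 0 + (a + b * 0)) (at 0)"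
    by (rule tendsto_add)
  then show ?thesis by simp
qed

text \<open>As the inner slope is zero, one derivative of \<open>\<psi>\<close> is enough: the
  increment of \<open>\<psi>\<close> is bounded by that of \<open>f\<close>, which is already
  quadratic. This covers inverses, roots and real powers alike.\<close>

lemma lin_exp_compose_flat:
  assumes f: "lin_exp f a 0" and \<psi>: "(\<psi> has_real_derivative d) (at a)"
  shows "lin_exp (\<lambda>t. \<psi> (f t)) (\<psi> a) 0"
proof -
  have "((\<lambda>y. (\<psi> y - \<psi> a) / (y - a)) \<longlongrightarrow> d) (at a)"
    using \<psi> by (simp add: has_field_derivative_iff)
  then have "(\<lambda>y. \<psi> y - \<psi> a) \<in> O[at a](\<lambda>y. y - a)"
    by (rule bigoI_tendsto) (simp add: eventually_at_filter)
  then obtain C where "\<forall>\<^sub>F y in at a. norm (\<psi> y - \<psi> a) \<le> C * norm (y - a)"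
    by (elim landau_o.bigE) blast
  \<comment> \<open>\<open>f t\<close> may equal \<open>a\<close>, so the bound is extended to
    \<open>a\<close> itself, where both sides are zero.\<close>
  then have "\<forall>\<^sub>F y in nhds a. norm (\<psi> y - \<psi> a) \<le> C * norm (y - a)"
    by (simp add: eventually_nhds_conv_at)
  then have "\<forall>\<^sub>F t in at 0. norm (\<psi> (f t) - \<psi> a) \<le> C * norm (f t - a)"
    by (rule eventually_compose_filterlim[OF _ lin_exp_tendsto[OF f]])
  then have "(\<lambda>t. \<psi> (f t) - \<psi> a) \<in> O[at 0](\<lambda>t. f t - a)"
    by (rule bigoI)
  also have "(\<lambda>t. f t - a) \<in> O[at 0](\<lambda>t. t^2)"
    using f by (simp add: lin_exp_def)
  finally show ?thesis by (simp add: lin_exp_def)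
qed

text \<open>Taylor's formula with Lagrange remainder; halving the radius gives a compact interval on
  which the second derivative is bounded.\<close>

lemma lin_exp_smooth:
  assumes "r > 0" "smooth_on (ball 0 r) \<phi>"
  shows "lin_exp \<phi> (\<phi> 0) (deriv \<phi> 0)"
proof -
  let ?d = "\<lambda>m. (deriv ^^ m) \<phi>"
  have s: "smooth_on (ball 0 r) (?d m)" for m
    by (induction m) (auto intro: assms smooth_on_deriv)
  have der: "(?d m has_real_derivative ?d (Suc m) x) (at x)" if "x \<in> ball 0 r" for x m
    using smooth_on_has_real_derivative[OF s _ that, of m] by simp
  have "isCont (?d 2) x" if "x \<in> {- (r/2)..r/2}" for x
    by (rule DERIV_isCont[OF der]) (use that assms(1) in \<open>auto simp: dist_real_def\<close>)
  then have "continuous_on {- (r/2)..r/2} (?d 2)"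
    by (simp add: continuous_at_imp_continuous_on)
  then have "bounded (?d 2 ` {- (r/2)..r/2})"
    by (intro compact_imp_bounded compact_continuous_image) auto
  then obtain M where M: "\<And>x. x \<in> {- (r/2)..r/2} \<Longrightarrow> \<bar>?d 2 x\<bar> \<le> M"
    unfolding bounded_iff real_norm_def by blast
  have dd: "\<forall>m x. m < 2 \<and> - (r/2) \<le> x \<and> x \<le> r/2 \<longrightarrow> (?d m has_real_derivative ?d (Suc m) x) (at x)"
    by (intro allI impI der) (use assms(1) in \<open>auto simp: dist_real_def\<close>)
  have bound: "\<bar>\<phi> t - (\<phi> 0 + deriv \<phi> 0 * t)\<bar> \<le> M / 2 * \<bar>t^2\<bar>" if t: "t \<noteq> 0" "\<bar>t\<bar> \<le> r/2" for t
  proof -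
    have tb: "- (r/2) \<le> t" "t \<le> r/2" using t(2) by auto
    obtain z where z: "if t < 0 then t < z \<and> z < 0 else 0 < z \<and> z < t"
      and eq: "\<phi> t = (\<Sum>m<2. ?d m 0 / fact m * (t - 0)^m) + ?d 2 z / fact 2 * (t - 0)^2"
      using Taylor[of 2 ?d \<phi> "- (r/2)" "r/2" 0 t, OF _ _ dd _ _ tb t(1)] assms(1) by auto
    have "\<bar>?d 2 z\<bar> \<le> M" using z t by (intro M) (auto split: if_splits)
    then have "\<bar>?d 2 z / 2 * t^2\<bar> \<le> M / 2 * \<bar>t^2\<bar>"
      by (simp add: abs_mult mult_right_mono)
    moreover have "\<phi> t - (\<phi> 0 + deriv \<phi> 0 * t) = ?d 2 z / 2 * t^2"
      using eq by (simp add: numeral_2_eq_2)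
    ultimately show ?thesis by (simp only:)
  qed
  have "\<forall>\<^sub>F t in at 0. norm (\<phi> t - (\<phi> 0 + deriv \<phi> 0 * t)) \<le> M / 2 * norm (t^2)"
    unfolding eventually_at using bound assms(1)
    by (intro exI[of _ "r/2"]) (auto simp: dist_real_def)
  then show ?thesis unfolding lin_exp_def by (rule bigoI)
qed

section \<open>Expansions of the closed forms\<close>

lemma lin_exp_cusp_xi:
  assumes a: "lin_exp a 0 \<alpha>" and b: "lin_exp b 0 \<beta>" and c: "lin_exp c 0 \<gamma>"
  shows "lin_exp (\<lambda>t. 1 + (a t)^2 + (b t)^2) 1 0"
    and "lin_exp (\<lambda>t. cusp_xi (a t) (b t) (c t)) 0 (- 2 * \<alpha>)"
    and "lin_exp (\<lambda>t. cusp_N (a t) (b t) (c t)) 2 0"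
proof -
  show W: "lin_exp (\<lambda>t. 1 + (a t)^2 + (b t)^2) 1 0"
    using lin_exp_add[OF lin_exp_add[OF lin_exp_const[of 1] lin_exp_mult[OF a a]] lin_exp_mult[OF b b]]
    by (simp add: power2_eq_square)
  have "(inverse has_real_derivative - (inverse 1 ^ Suc (Suc 0))) (at 1)"
    by (rule DERIV_inverse) simp
  from lin_exp_compose_flat[OF W this]
  have "lin_exp (\<lambda>t. inverse (1 + (a t)^2 + (b t)^2)) 1 0" by simp
  \<comment> \<open>The product of \<open>c\<close> and \<open>b\<close> is of second order, so the
    slope comes from \<open>a\<close> alone.\<close>
  from lin_exp_mult[OF lin_exp_mult[OF lin_exp_const[of "-2"] lin_exp_add[OF a lin_exp_mult[OF c b]]] this]
  show "lin_exp (\<lambda>t. cusp_xi (a t) (b t) (c t)) 0 (- 2 * \<alpha>)"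
    by (simp add: cusp_xi_def divide_inverse)
  have "lin_exp (\<lambda>t. 1 + (c t)^2 + (c t * a t - b t)^2) 1 0"
    using lin_exp_add[OF lin_exp_add[OF lin_exp_const[of 1] lin_exp_mult[OF c c]]
      lin_exp_mult[OF lin_exp_diff[OF lin_exp_mult[OF c a] b] lin_exp_diff[OF lin_exp_mult[OF c a] b]]]
    by (simp add: power2_eq_square)
  from lin_exp_compose_flat[OF this DERIV_real_sqrt]
  have "lin_exp (\<lambda>t. sqrt (1 + (c t)^2 + (c t * a t - b t)^2)) 1 0" by simp
  from lin_exp_mult[OF lin_exp_const[of 2] this]
  show "lin_exp (\<lambda>t. cusp_N (a t) (b t) (c t)) 2 0"
    by (simp add: cusp_N_def)
qed

text \<open>The square of \<open>\<xi>\<close> is quadratic, which removes the second derivatives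
  \<open>a'\<close>, \<open>b'\<close>. To first order only \<open>48 * k\<close> and
  \<open>24 * c' * \<xi>\<close> remain, scaled by \<open>1 / 8\<close> from the cube of
  \<open>cusp_N\<close>.\<close>

lemma lin_exp_cusp_bias:
  assumes a: "lin_exp a 0 \<alpha>" and b: "lin_exp b 0 \<beta>" and c: "lin_exp c 0 \<gamma>"
    and a': "lin_exp a' a0 a1" and b': "lin_exp b' b0 b1" and c': "lin_exp c' c0 c1"
    and k: "lin_exp k k0 k1"
  shows "lin_exp (\<lambda>t. cusp_bias (a t) (b t) (a' t) (b' t) (c t) (c' t) (k t))
    (6 * k0) (6 * (k1 - \<alpha> * c0))"
proof -
  note W = lin_exp_cusp_xi(1)[OF a b c] and xi = lin_exp_cusp_xi(2)[OF a b c]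
    and N = lin_exp_cusp_xi(3)[OF a b c]
  have "((\<lambda>x::real. inverse (x ^ 3)) has_real_derivative
      - (inverse (2 ^ 3) * (real 3 * (1 * 2 ^ (3 - Suc 0))) * inverse (2 ^ 3))) (at 2)"
    by (intro DERIV_inverse' DERIV_power DERIV_ident) simp
  from lin_exp_compose_flat[OF N this]
  have N3: "lin_exp (\<lambda>t. inverse (cusp_N (a t) (b t) (c t) ^ 3)) (1 / 8) 0" by simp
  have "lin_exp (\<lambda>t. 6 * (b' t - c t * a' t) * (cusp_xi (a t) (b t) (c t) * cusp_xi (a t) (b t) (c t))
      + 24 * c' t * cusp_xi (a t) (b t) (c t) + 48 * k t) (48 * k0) (48 * k1 - 48 * \<alpha> * c0)"
    using lin_exp_add[OF lin_exp_add[OF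
        lin_exp_mult[OF lin_exp_mult[OF lin_exp_const[of 6] lin_exp_diff[OF b' lin_exp_mult[OF c a']]]
          lin_exp_mult[OF xi xi]]
        lin_exp_mult[OF lin_exp_mult[OF lin_exp_const[of 24] c'] xi]] lin_exp_mult[OF lin_exp_const[of 48] k]]
    by (simp add: algebra_simps)
  from lin_exp_mult[OF lin_exp_mult[OF W this] N3] show ?thesis
    unfolding cusp_bias_def divide_inverse power2_eq_square[of "cusp_xi _ _ _"]
    by (simp add: right_diff_distrib diff_divide_distrib mult.assoc)
qed

text \<open>Both \<open>c1'\<close> and \<open>\<xi>\<close> vanish at the origin, so their product
  is quadratic. The constant is \<open>720 * sqrt 2 / 16 = 45 * sqrt 2\<close>.\<close>

lemma lin_exp_cusp_sec:
  assumes a: "lin_exp a 0 \<alpha>" and b: "lin_exp b 0 \<beta>" and c: "lin_exp c 0 \<gamma>"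
    and c1': "lin_exp c1' 0 c1" and k: "lin_exp k k0 k1"
  shows "lin_exp (\<lambda>t. cusp_sec (a t) (b t) (c t) (c1' t) (k t)) (45 * sqrt 2 * k0) (45 * sqrt 2 * k1)"
proof -
  note W = lin_exp_cusp_xi(1)[OF a b c] and xi = lin_exp_cusp_xi(2)[OF a b c]
    and N = lin_exp_cusp_xi(3)[OF a b c]
  have "lin_exp (\<lambda>t. sqrt (1 + (a t)^2 + (b t)^2)) 1 0"
    using lin_exp_compose_flat[OF W DERIV_real_sqrt] by simp
  from lin_exp_compose_flat[OF this has_real_derivative_powr[of 1 "5/2"]]
  have W': "lin_exp (\<lambda>t. sqrt (1 + (a t)^2 + (b t)^2) powr (5/2)) 1 0" by simp
  have "lin_exp (\<lambda>t. cusp_N (a t) (b t) (c t) powr - (7/2)) (2 powr - (7/2)) 0"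
    by (rule lin_exp_compose_flat[OF N has_real_derivative_powr[of 2 "- (7/2)"]]) simp
  moreover have "(2::real) powr - (7/2) = sqrt 2 / 16"
  proof -
    have "(2::real) powr - (7/2) = 2 powr (1/2 + - 4)" by simp
    also have "\<dots> = 2 powr (1/2) * 2 powr (- 4)" by (rule powr_add)
    also have "(2::real) powr (- 4) = 1 / 16" using powr_minus_divide[of "2::real" 4] powr_realpow[of "2::real" 4] by simp
    finally show ?thesis by (simp add: powr_half_sqrt)
  qed
  ultimately have N': "lin_exp (\<lambda>t. cusp_N (a t) (b t) (c t) powr - (7/2)) (sqrt 2 / 16) 0" by simp
  have "lin_exp (\<lambda>t. 720 * k t + 360 * c1' t * cusp_xi (a t) (b t) (c t)) (720 * k0) (720 * k1)"
    using lin_exp_add[OF lin_exp_mult[OF lin_exp_const[of 720] k]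
      lin_exp_mult[OF lin_exp_mult[OF lin_exp_const[of 360] c1'] xi]] by simp
  from lin_exp_mult[OF lin_exp_mult[OF W' this] N'] show ?thesis
    unfolding cusp_sec_def divide_inverse powr_minus[symmetric] by (simp add: mult_ac)
qed

section \<open>Partial derivatives on slices and expansions along the curve\<close>

lemma slice_deriv:
  fixes g :: "real \<times> real \<Rightarrow> real"
  assumes "open T" "smooth_on T g" "(x, s) \<in> T"
  shows "deriv (\<lambda>x. g (x, s)) x = partial_u g (x, s)"
proof -
  have "((\<lambda>x. (x, s)) has_derivative (\<lambda>w. (w, 0))) (at x)"
    by (intro derivative_eq_intros) auto
  from has_derivative_compose[OF this smooth_on_has_derivative[OF assms(2,1,3)]]
  have d: "((\<lambda>x. g (x, s)) has_derivative (\<lambda>w. frechet_derivative g (at (x, s)) (w, 0))) (at x)" .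
  then have "frechet_derivative g (at (x, s)) (w, 0) = partial_u g (x, s) * w" for w
    using linear_scale[OF has_derivative_linear[OF d], of w 1] by (simp add: partial_u_def)
  with d have "((\<lambda>x. g (x, s)) has_real_derivative partial_u g (x, s)) (at x)"
    by (simp add: has_field_derivative_def)
  then show ?thesis by (rule DERIV_imp_deriv)
qed

lemma smooth_on_partial_u:
  "smooth_on T g \<Longrightarrow> smooth_on T (partial_u g)"
  using smooth_on_frechet[of T g "(1, 0)"] unfolding partial_u_def[abs_def] .

lemma open_slice: "open T \<Longrightarrow> open {x::real. (x, s::real) \<in> T}"
  using open_vimage[of T "\<lambda>x. (x, s)"] by (simp add: vimage_def continuous_on_Pair continuous_on_id)

lemma smooth_on_slice:
  fixes g :: "real \<times> real \<Rightarrow> real"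
  assumes "open T" "smooth_on T g"
  shows "smooth_on {x. (x, s) \<in> T} (\<lambda>x. g (x, s))"
  using open_slice[OF assms(1)] assms
  by (intro smooth_on_compose[of _ T "\<lambda>x. (x, s)" g] smooth_on_Pair smooth_on_id smooth_on_const) auto

lemma slice_deriv2:
  fixes g :: "real \<times> real \<Rightarrow> real"
  assumes "open T" "smooth_on T g" "(x, s) \<in> T"
  shows "deriv (deriv (\<lambda>x. g (x, s))) x = partial_u (partial_u g) (x, s)"
proof -
  \<comment> \<open>The outer derivative needs the first-order identity on a whole neighbourhood of
    \<open>x\<close>.\<close>
  have "\<forall>\<^sub>F y in nhds x. y \<in> {x. (x, s) \<in> T}"
    using open_slice[OF assms(1)] assms(3) by (intro eventually_nhds_in_open) auto
  then have "\<forall>\<^sub>F y in nhds x. deriv (\<lambda>x. g (x, s)) y = partial_u g (y, s)"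
    by eventually_elim (use slice_deriv[OF assms(1,2)] in auto)
  then have "deriv (deriv (\<lambda>x. g (x, s))) x = deriv (\<lambda>y. partial_u g (y, s)) x"
    by (intro deriv_cong_ev) auto
  also have "\<dots> = partial_u (partial_u g) (x, s)"
    by (rule slice_deriv[OF assms(1) smooth_on_partial_u[OF assms(2)] assms(3)])
  finally show ?thesis .
qed

text \<open>The second coordinate \<open>- (t^2)\<close> has zero velocity at the origin, so only
  \<open>partial_u\<close> contributes to the slope.\<close>

lemma lin_exp_along_curve:
  fixes g :: "real \<times> real \<Rightarrow> real"
  assumes "e > 0" "smooth_on (ball 0 e) g" "smooth_on (ball 0 e) u" "u 0 = 0"
    and u': "(u has_real_derivative w) (at 0)"
  shows "lin_exp (\<lambda>t. g (u t, - (t^2))) (g (0, 0)) (partial_u g (0, 0) * w)"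
proof -
  let ?F = "\<lambda>t. (u t, - (t^2))"
  have F': "(?F has_derivative (\<lambda>k. (w * k, 0))) (at 0)"
    using u' unfolding has_field_derivative_def
    by (auto intro!: derivative_eq_intros)
  have "isCont ?F 0" using F' has_derivative_continuous by blast
  then have "\<forall>\<^sub>F t in nhds 0. ?F t \<in> ball 0 e"
    using assms(1,4)
    by (intro topological_tendstoD[of ?F "(0, 0)" "nhds 0"])
      (auto simp: isCont_def tendsto_nhds_iff zero_prod_def)
  then obtain r where r: "r > 0" "\<And>t. \<bar>t\<bar> < r \<Longrightarrow> ?F t \<in> ball 0 e"
    unfolding eventually_nhds_metric by (auto simp: dist_real_def)
  define q where "q = min r e"
  have q: "q > 0" using r assms(1) by (simp add: q_def)
  have "smooth_on (ball 0 q) u" using assms(3) by (rule smooth_on_subset) (auto simp: q_def)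
  moreover have "smooth_on (ball 0 q) (\<lambda>t::real. - 1 * t^2)"
    by (intro smooth_on_mult smooth_on_const smooth_on_power smooth_on_id open_ball)
  ultimately have "smooth_on (ball 0 q) ?F" using smooth_on_Pair[OF open_ball] by fastforce
  then have sm: "smooth_on (ball 0 q) (\<lambda>t. g (?F t))"
    using r(2) by (intro smooth_on_compose[OF open_ball open_ball _ assms(2)]) (auto simp: q_def dist_real_def)
  have "(g has_derivative frechet_derivative g (at (0, 0))) (at (u 0, - (0^2)))"
    using smooth_on_has_derivative[OF assms(2), of "(0, 0)"] assms(1,4) by (simp add: zero_prod_def[symmetric])
  from has_derivative_compose[OF F' this]
  have d: "((\<lambda>t. g (?F t)) has_derivative (\<lambda>k. frechet_derivative g (at (0, 0)) (w * k, 0))) (at 0)" .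
  have lin: "linear (frechet_derivative g (at (0, 0)))"
    using smooth_on_has_derivative[OF assms(2), of "(0, 0)"] assms(1) has_derivative_linear
    by (simp add: zero_prod_def[symmetric])
  have "frechet_derivative g (at (0, 0)) (w * k, 0) = partial_u g (0, 0) * w * k" for k
    using linear_scale[OF lin, of "w * k" "(1, 0)"] by (simp add: partial_u_def)
  with d have "((\<lambda>t. g (?F t)) has_real_derivative partial_u g (0, 0) * w) (at 0)"
    by (simp add: has_field_derivative_def)
  then have "deriv (\<lambda>t. g (?F t)) 0 = partial_u g (0, 0) * w" by (rule DERIV_imp_deriv)
  with lin_exp_smooth[OF q sm] assms(4) show ?thesis by simp
qed

lemma fst_ball_subset: "fst ` ball (0 :: real \<times> real) e \<subseteq> ball 0 e"
  and snd_ball_subset: "snd ` ball (0 :: real \<times> real) e \<subseteq> ball 0 e"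
  using dist_fst_le[of 0] dist_snd_le[of 0]
  by (auto simp: image_subset_iff simp del: split_paired_All dist_0_norm elim!: le_less_trans[rotated])

text \<open>This is the shape of the second and third components at \<open>v = 0\<close>.
  Derivatives in \<open>u\<close> at the origin see only the slice \<open>s = 0\<close>, where the
  mixed term is absent and \<open>x^2 * f x\<close> remains.\<close>

lemma partial_u_quadratic:
  fixes f :: "real \<Rightarrow> real" and k :: "real \<times> real \<Rightarrow> real"
  assumes "e > 0" "smooth_on (ball 0 e) f" "smooth_on (ball 0 e) k"
  defines "G \<equiv> (\<lambda>q. fst q ^ 2 * f (fst q) + fst q * snd q * k q)"
  shows "smooth_on (ball 0 e) G"
    and "partial_u G (0, 0) = 0" and "partial_u (partial_u G) (0, 0) = 2 * f 0"
proof -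
  have "fst ` ball (0 :: real \<times> real) e \<subseteq> ball 0 e"
    by (rule fst_ball_subset)
  then have "smooth_on (ball 0 e :: (real \<times> real) set) (\<lambda>q. f (fst q))"
    using smooth_on_compose[OF open_ball open_ball smooth_on_fst[OF open_ball] assms(2)] by blast
  then show s: "smooth_on (ball 0 e) G"
    unfolding G_def
    by (intro smooth_on_add smooth_on_mult smooth_on_power smooth_on_fst smooth_on_snd open_ball assms)
  have 0: "(0, 0) \<in> ball (0 :: real \<times> real) e" using assms(1) by (simp add: zero_prod_def[symmetric])
  have G: "(\<lambda>x. G (x, 0)) = (\<lambda>x. x^2 * f x)" by (simp add: G_def)
  have f': "(f has_real_derivative deriv f x) (at x)" if "x \<in> ball 0 e" for x
    by (rule smooth_on_has_real_derivative[OF assms(2) open_ball that])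
  have dG: "deriv (\<lambda>x. x^2 * f x) x = 2 * x * f x + x^2 * deriv f x" if "x \<in> ball 0 e" for x
    by (rule DERIV_imp_deriv) (auto intro!: derivative_eq_intros f'[OF that])
  show "partial_u G (0, 0) = 0"
    using slice_deriv[OF open_ball s 0] dG[of 0] assms(1) unfolding G by simp
  have "\<forall>\<^sub>F x in nhds 0. x \<in> ball (0::real) e"
    using assms(1) by (intro eventually_nhds_in_open) auto
  then have "\<forall>\<^sub>F x in nhds 0. deriv (\<lambda>x. x^2 * f x) x = 2 * x * f x + x^2 * deriv f x"
    by eventually_elim (rule dG)
  then have "deriv (deriv (\<lambda>x. x^2 * f x)) 0 = deriv (\<lambda>x. 2 * x * f x + x^2 * deriv f x) 0"
    by (intro deriv_cong_ev) auto
  also have "\<dots> = 2 * f 0"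
  proof (rule DERIV_imp_deriv)
    have 0: "0 \<in> ball (0::real) e" using assms(1) by simp
    show "((\<lambda>x. 2 * x * f x + x^2 * deriv f x) has_real_derivative 2 * f 0) (at 0)"
      by (auto intro!: derivative_eq_intros f'[OF 0]
        smooth_on_has_real_derivative[OF smooth_on_deriv[OF open_ball assms(2)] open_ball 0])
  qed
  finally show "partial_u (partial_u G) (0, 0) = 2 * f 0"
    using slice_deriv2[OF open_ball s 0] unfolding G by simp
qed

text \<open>\<open>v\<close> enters only through \<open>v^2\<close>, whose derivative vanishes at
  \<open>v = 0\<close>.\<close>

lemma frechet_even_slice:
  fixes k :: "real \<times> real \<times> real \<Rightarrow> real"
  assumes "open T" "smooth_on T k" "(x, 0, s) \<in> T"
  shows "frechet_derivative (\<lambda>q. k (fst q, snd q ^ 2, s)) (at (x, 0)) (0, 1) = 0"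
proof -
  have F: "((\<lambda>q::real \<times> real. (fst q, snd q ^ 2, s)) has_derivative (\<lambda>w. (fst w, 0, 0))) (at (x, 0))"
    by (auto intro!: derivative_eq_intros)
  have k: "(k has_derivative frechet_derivative k (at (x, 0, s))) (at (fst (x, 0::real), snd (x, 0::real) ^ 2, s))"
    using smooth_on_has_derivative[OF assms(2,1,3)] by simp
  have "frechet_derivative (\<lambda>q. k (fst q, snd q ^ 2, s)) (at (x, 0))
      = (\<lambda>w. frechet_derivative k (at (x, 0, s)) (fst w, 0, 0))"
    using frechet_derivative_at[OF has_derivative_compose[OF F k]] by simp
  moreover have "linear (frechet_derivative k (at (x, 0, s)))"
    using k has_derivative_linear by blast
  ultimately show ?thesis
    using linear_0 by (fastforce simp: zero_prod_def)
qed

section \<open>Bias and secondary cuspidal curvature along the curve of cuspidal cross caps\<close>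

theorem theorem4p5:
  fixes f21 f31 d1 d2 d3 :: "real \<Rightarrow> real"
    and f24 f34 c0 d4 :: "real \<times> real \<Rightarrow> real"
    and c2 c3 :: "real \<times> real \<times> real \<Rightarrow> real"
    and u :: "real \<Rightarrow> real"
    and \<epsilon> :: real
  defines "c1 \<equiv> c1_of d1 d2 d3 d4"
    and "d20 \<equiv> sqrt (d2 0)"
    and "h \<equiv> (\<lambda>t. f_map f21 f24 f31 f34 (f32_of c0 d1 d2 d3 d4 c2 c3) (- (t ^ 2)))"
  assumes eps: "\<epsilon> > 0"
    and sm: "smooth_on (ball 0 \<epsilon>) f21" "smooth_on (ball 0 \<epsilon>) f31"
      "smooth_on (ball 0 \<epsilon>) d1" "smooth_on (ball 0 \<epsilon>) d2" "smooth_on (ball 0 \<epsilon>) d3"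
      "smooth_on (ball 0 \<epsilon>) f24" "smooth_on (ball 0 \<epsilon>) f34"
      "smooth_on (ball 0 \<epsilon>) c0" "smooth_on (ball 0 \<epsilon>) d4"
      "smooth_on (ball 0 \<epsilon>) c2" "smooth_on (ball 0 \<epsilon>) c3"
    and c00: "c0 (0, 0) = 0"
    and c3ne: "c3 (0, 0, 0) \<noteq> 0"
    and d2pos: "d2 0 > 0"
    and u_smooth: "smooth_on (ball 0 \<epsilon>) u"
    and u_root: "\<forall>t. t \<noteq> 0 \<and> \<bar>t\<bar> < \<epsilon> \<longrightarrow> c1 (u t) (- (t ^ 2)) = 0"
    and u_exp: "\<exists>C. \<forall>t. \<bar>t\<bar> < \<epsilon> \<longrightarrow> \<bar>u t - t / d20\<bar> \<le> C * t^2"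
  shows "(\<exists>\<delta>>0. \<forall>t. t \<noteq> 0 \<and> \<bar>t\<bar> < \<delta> \<longrightarrow>
            (\<exists>eta l. admissible_field (h t) (u t, 0) eta l)) \<and>
         (\<exists>\<delta>>0. \<exists>C. \<forall>t eta l. t \<noteq> 0 \<and> \<bar>t\<bar> < \<delta> \<and> admissible_field (h t) (u t, 0) eta l \<longrightarrow>
            \<bar>bias (h t) (u t, 0) eta
               - (6 * c2 (0, 0, 0)
                  + 6 * (- 2 * f21 0 * deriv (\<lambda>x. c0 (x, 0)) 0 + deriv (\<lambda>x. c2 (x, 0, 0)) 0) / d20 * t)\<bar>
              \<le> C * t^2) \<and>
         (\<exists>\<delta>>0. \<exists>C. \<forall>t eta l. t \<noteq> 0 \<and> \<bar>t\<bar> < \<delta> \<and> admissible_field (h t) (u t, 0) eta l \<longrightarrow>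
            \<bar>sec_cusp_curv (h t) (u t, 0) eta l
               - (45 * sqrt 2 * c3 (0, 0, 0)
                  + 45 * sqrt 2 * deriv (\<lambda>x. c3 (x, 0, 0)) 0 / d20 * t)\<bar>
              \<le> C * t^2)"
proof -
  let ?U = "ball (0 :: real \<times> real) \<epsilon>"
  \<comment> \<open>Coefficients are kept as functions of \<open>(u, s)\<close>: a slice in
    \<open>s\<close> supplies the normal form, while partial derivatives can be expanded along the
    curve.\<close>
  define FA where "FA = (\<lambda>q. fst q ^ 2 * f21 (fst q) + fst q * snd q * f24 q)"
  define FB where "FB = (\<lambda>q. fst q ^ 2 * f31 (fst q) + fst q * snd q * f34 q)"
  define FC where "FC = (\<lambda>q. c1 (fst q) (snd q))"
  define k2 where "k2 = (\<lambda>q :: real \<times> real. c2 (fst q, 0, snd q))"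
  define k3 where "k3 = (\<lambda>q :: real \<times> real. c3 (fst q, 0, snd q))"
  have FA: "smooth_on ?U FA" "partial_u FA (0, 0) = 0" "partial_u (partial_u FA) (0, 0) = 2 * f21 0"
    unfolding FA_def by (rule partial_u_quadratic[OF eps sm(1,6)])+
  have FB: "smooth_on ?U FB" "partial_u FB (0, 0) = 0"
    unfolding FB_def by (rule partial_u_quadratic[OF eps sm(2,7)])+
  have FC: "smooth_on ?U FC"
  proof -
    have s: "smooth_on ?U (\<lambda>q. d (snd q))" if "smooth_on (ball 0 \<epsilon>) d" for d :: "real \<Rightarrow> real"
      using smooth_on_compose[OF open_ball open_ball smooth_on_snd[OF open_ball] that snd_ball_subset] .
    show ?thesis
      unfolding FC_def c1_def c1_of_def
      by (intro smooth_on_add smooth_on_mult smooth_on_power smooth_on_fst smooth_on_snd open_ball)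
        (auto intro: s sm)
  qed
  have 0: "(0, 0) \<in> ?U" using eps by (simp add: zero_prod_def[symmetric])
  \<comment> \<open>On \<open>s = 0\<close> the coefficient \<open>c1\<close> starts with
    \<open>u^2 * d2 0\<close>, so it has no linear term.\<close>
  have FC0: "partial_u FC (0, 0) = 0"
  proof -
    have "((\<lambda>x. d4 (x, 0)) has_real_derivative deriv (\<lambda>x. d4 (x, 0)) 0) (at 0)"
      by (rule smooth_on_has_real_derivative[OF smooth_on_slice[OF open_ball sm(9)] open_slice[OF open_ball]])
        (use 0 in simp)
    then have "((\<lambda>x. x^2 * d2 0 + x^3 * d3 0 + x^4 * d4 (x, 0)) has_real_derivative 0) (at 0)"
      by (auto intro!: derivative_eq_intros)
    from DERIV_imp_deriv[OF this] show ?thesis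
      using slice_deriv[OF open_ball FC 0] by (simp add: FC_def c1_def c1_of_def)
  qed
  have k: "smooth_on ?U k2" "smooth_on ?U k3"
  proof -
    have s: "smooth_on ?U (\<lambda>q. (fst q, 0 :: real, snd q))"
      by (intro smooth_on_Pair smooth_on_fst smooth_on_snd smooth_on_const open_ball)
    have "(\<lambda>q. (fst q, 0 :: real, snd q)) ` ?U \<subseteq> ball 0 \<epsilon>"
      by (auto simp: norm_Pair)
    then show "smooth_on ?U k2" "smooth_on ?U k3"
      unfolding k2_def k3_def using smooth_on_compose[OF open_ball open_ball s] sm(10,11) by blast+
  qed
  obtain C where C: "\<And>t. \<bar>t\<bar> < \<epsilon> \<Longrightarrow> \<bar>u t - t / d20\<bar> \<le> C * t^2"
    using u_exp by blast
  have u0: "u 0 = 0" using C[of 0] eps by simp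
  \<comment> \<open>The quadratic error bound, divided by \<open>t\<close>, controls the difference
    quotient.\<close>
  have u': "(u has_real_derivative 1 / d20) (at 0)"
  proof -
    have bd: "\<forall>\<^sub>F t in at 0. norm (u t / t - 1 / d20) \<le> \<bar>C\<bar> * \<bar>t\<bar>"
      unfolding eventually_at
    proof (intro exI[of _ \<epsilon>] conjI ballI impI eps)
      fix t :: real assume t: "t \<noteq> 0 \<and> dist t 0 < \<epsilon>"
      have "norm (u t / t - 1 / d20) = \<bar>u t - t / d20\<bar> / \<bar>t\<bar>"
        using t by (simp add: abs_divide[symmetric] diff_divide_distrib)
      also have "\<dots> \<le> \<bar>C\<bar> * t^2 / \<bar>t\<bar>"
        using C[of t] t order_trans[OF _ mult_right_mono[of C "\<bar>C\<bar>" "t^2"]]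
        by (intro divide_right_mono) auto
      also have "\<dots> = \<bar>C\<bar> * \<bar>t\<bar>"
        using t by (cases "t > 0") (simp_all add: power2_eq_square)
      finally show "norm (u t / t - 1 / d20) \<le> \<bar>C\<bar> * \<bar>t\<bar>" .
    qed
    moreover have "((\<lambda>t. \<bar>C\<bar> * \<bar>t\<bar>) \<longlongrightarrow> \<bar>C\<bar> * \<bar>0\<bar>) (at (0::real))"
      by (intro tendsto_intros)
    ultimately have "((\<lambda>t. u t / t - 1 / d20) \<longlongrightarrow> 0) (at 0)"
      using Lim_null_comparison[OF bd] by simp
    then show ?thesis
      using Lim_null[of "\<lambda>t. u t / t" "1 / d20" "at 0"] by (simp add: has_field_derivative_iff u0)
  qed
  note curve = lin_exp_along_curve[OF eps _ u_smooth u0 u']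
  have "((\<lambda>t. (u t, - (t^2))) \<longlongrightarrow> (u 0, - (0^2))) (at 0)"
    using DERIV_isCont[OF u'] by (intro tendsto_intros) (auto simp: isCont_def)
  then have near: "\<forall>\<^sub>F t in at 0. (u t, - (t^2)) \<in> ?U"
    using 0 by (intro topological_tendstoD[of _ "(0, 0)"]) (auto simp: u0)
  have "\<forall>\<^sub>F t in at 0. t \<noteq> 0 \<and> \<bar>t\<bar> < \<epsilon>"
    unfolding eventually_at using eps by (intro exI[of _ \<epsilon>]) auto
  \<comment> \<open>For each fixed small \<open>t\<close> the map is put into normal form with
    \<open>s = - (t^2)\<close>, and slice derivatives are rewritten as partial derivatives on the
    curve.\<close>
  with near have inv: "\<forall>\<^sub>F t in at 0. (\<exists>eta l. admissible_field (h t) (u t, 0) eta l) \<and>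
      (\<forall>eta l. admissible_field (h t) (u t, 0) eta l \<longrightarrow>
        bias (h t) (u t, 0) eta = cusp_bias (partial_u FA (u t, - (t^2))) (partial_u FB (u t, - (t^2)))
          (partial_u (partial_u FA) (u t, - (t^2))) (partial_u (partial_u FB) (u t, - (t^2)))
          (c0 (u t, - (t^2))) (partial_u c0 (u t, - (t^2))) (k2 (u t, - (t^2))) \<and>
        sec_cusp_curv (h t) (u t, 0) eta l = cusp_sec (partial_u FA (u t, - (t^2)))
          (partial_u FB (u t, - (t^2))) (c0 (u t, - (t^2))) (partial_u FC (u t, - (t^2)))
          (k3 (u t, - (t^2))))"
  proof eventually_elim
    case (elim t)
    define s where "s = - (t^2)"
    define I where "I = {x. (x, s) \<in> ?U}"
    define S where "S = {q :: real \<times> real. (fst q, snd q ^ 2, s) \<in> ball 0 \<epsilon>}"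
    have p: "(u t, s) \<in> ?U" using elim(1) by (simp add: s_def)
    have "open ((\<lambda>q :: real \<times> real. (fst q, snd q ^ 2, s)) -` ball 0 \<epsilon>)"
      by (intro open_vimage open_ball continuous_intros)
    then have S: "open S" by (simp add: S_def vimage_def)
    have I: "open I" unfolding I_def by (rule open_slice[OF open_ball])
    \<comment> \<open>Dropping the middle coordinate of \<open>(u, v^2, s)\<close> does not increase
      the norm.\<close>
    have SI: "fst ` S \<subseteq> I"
      unfolding S_def I_def
      by (auto simp: norm_Pair elim!: order.strict_trans1[rotated])
    have pS: "(u t, 0) \<in> S" using p by (simp add: S_def norm_Pair)
    have "smooth_on S (\<lambda>q. (fst q, snd q ^ 2, s))"
      by (intro smooth_on_Pair smooth_on_fst smooth_on_power smooth_on_snd smooth_on_const S)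
    note sS = smooth_on_compose[OF S open_ball this]
    have K: "smooth_on S (\<lambda>q. c2 (fst q, snd q ^ 2, s))" "smooth_on S (\<lambda>q. c3 (fst q, snd q ^ 2, s))"
      by (rule sS[OF sm(10)] sS[OF sm(11)]; auto simp: S_def)+
    interpret c: cusp_form S I "\<lambda>x. FA (x, s)" "\<lambda>x. FB (x, s)" "\<lambda>x. c0 (x, s)" "\<lambda>x. FC (x, s)"
      "\<lambda>q. c2 (fst q, snd q ^ 2, s)" "\<lambda>q. c3 (fst q, snd q ^ 2, s)"
      unfolding cusp_form_def using S I SI K FA(1) FB(1) FC sm(8)
        smooth_on_slice[OF open_ball] unfolding I_def by blast
    have h: "h t = c.h"
      unfolding h_def s_def[symmetric] f_map_def cusp_map_def f32_of_def FA_def FB_def FC_def c1_def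
      by (auto simp: fun_eq_iff algebra_simps eval_nat_numeral)
    have c1u: "FC (u t, s) = 0"
      using u_root elim(2) by (simp add: FC_def s_def)
    have "frechet_derivative (\<lambda>q. c2 (fst q, snd q ^ 2, s)) (at (u t, 0)) (0, 1) = 0"
      using pS by (intro frechet_even_slice[OF open_ball sm(10)]) (simp add: S_def)
    note inv = c.invariants_of_admissible[OF _ pS c1u this]
    note sl = slice_deriv[OF open_ball _ p] slice_deriv2[OF open_ball _ p]
    show ?case
      unfolding s_def[symmetric] h
      using c.admissible_field_exists[OF pS c1u] inv
      by (auto simp: sl[OF FA(1)] sl[OF FB(1)] sl[OF FC] sl[OF sm(8)] k2_def k3_def)
  qed
  \<comment> \<open>The slope \<open>2 * f21 0 / d20\<close> obtained here plays the role of
    \<open>\<alpha>\<close> in \<open>lin_exp_cusp_bias\<close> and is the source of the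
    \<open>f21\<close> term.\<close>
  note a = curve[OF smooth_on_partial_u[OF FA(1)], unfolded FA(2,3)]
  note b = curve[OF smooth_on_partial_u[OF FB(1)], unfolded FB(2)]
  note cc = curve[OF sm(8), unfolded c00]
  note a' = curve[OF smooth_on_partial_u[OF smooth_on_partial_u[OF FA(1)]]]
  note b' = curve[OF smooth_on_partial_u[OF smooth_on_partial_u[OF FB(1)]]]
  note c' = curve[OF smooth_on_partial_u[OF sm(8)]]
  note FC' = curve[OF smooth_on_partial_u[OF FC], unfolded FC0]
  have dc0: "partial_u c0 (0, 0) = deriv (\<lambda>x. c0 (x, 0)) 0"
    and dk2: "partial_u k2 (0, 0) = deriv (\<lambda>x. c2 (x, 0, 0)) 0"
    and dk3: "partial_u k3 (0, 0) = deriv (\<lambda>x. c3 (x, 0, 0)) 0"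
    using slice_deriv[OF open_ball sm(8) 0] slice_deriv[OF open_ball k(1) 0]
      slice_deriv[OF open_ball k(2) 0] by (simp_all add: k2_def k3_def)
  \<comment> \<open>\<open>\<delta>\<close> and \<open>C\<close> must serve all admissible fields at
    once; they can, because \<open>g\<close> depends on \<open>t\<close> alone.\<close>
  have uniform_bound: "\<exists>\<delta>>0. \<exists>C. \<forall>t eta l. t \<noteq> 0 \<and> \<bar>t\<bar> < \<delta> \<and> admissible_field (h t) (u t, 0) eta l \<longrightarrow>
      \<bar>r t eta l - (r0 + r1 * t)\<bar> \<le> C * t^2"
    if g: "lin_exp g r0 r1"
      and ev: "\<forall>\<^sub>F t in at 0. \<forall>eta l. admissible_field (h t) (u t, 0) eta l \<longrightarrow> r t eta l = g t"
    for r :: "real \<Rightarrow> (real \<times> real \<Rightarrow> real \<times> real) \<Rightarrow> real \<Rightarrow> real" and g r0 r1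
  proof -
    obtain C where "\<forall>\<^sub>F t in at 0. norm (g t - (r0 + r1 * t)) \<le> C * norm (t^2)"
      using g unfolding lin_exp_def by (elim landau_o.bigE) blast
    with ev have "\<forall>\<^sub>F t in at 0. \<forall>eta l. admissible_field (h t) (u t, 0) eta l \<longrightarrow>
        \<bar>r t eta l - (r0 + r1 * t)\<bar> \<le> C * t^2"
      by eventually_elim auto
    then show ?thesis unfolding eventually_at by (simp add: dist_real_def) blast
  qed
  show ?thesis
  proof (intro conjI)
    have "\<forall>\<^sub>F t in at 0. \<exists>eta l. admissible_field (h t) (u t, 0) eta l"
      using inv by eventually_elim blast
    then show "\<exists>\<delta>>0. \<forall>t. t \<noteq> 0 \<and> \<bar>t\<bar> < \<delta> \<longrightarrow> (\<exists>eta l. admissible_field (h t) (u t, 0) eta l)"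
      unfolding eventually_at by (auto simp: dist_real_def)
  next
    have slope: "6 * (partial_u k2 (0, 0) * (1 / d20) - 2 * f21 0 * (1 / d20) * partial_u c0 (0, 0))
        = 6 * (- 2 * f21 0 * deriv (\<lambda>x. c0 (x, 0)) 0 + deriv (\<lambda>x. c2 (x, 0, 0)) 0) / d20"
      unfolding dc0 dk2 by (simp add: algebra_simps add_divide_distrib diff_divide_distrib)
    show "\<exists>\<delta>>0. \<exists>C. \<forall>t eta l. t \<noteq> 0 \<and> \<bar>t\<bar> < \<delta> \<and> admissible_field (h t) (u t, 0) eta l \<longrightarrow>
            \<bar>bias (h t) (u t, 0) eta
               - (6 * c2 (0, 0, 0)
                  + 6 * (- 2 * f21 0 * deriv (\<lambda>x. c0 (x, 0)) 0 + deriv (\<lambda>x. c2 (x, 0, 0)) 0) / d20 * t)\<bar>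
              \<le> C * t^2"
      by (rule uniform_bound[OF lin_exp_cusp_bias[OF a b cc a' b' c' curve[OF k(1)], unfolded slope,
              unfolded k2_def fst_conv snd_conv]])
        (use inv in \<open>eventually_elim, simp add: k2_def\<close>)
  next
    show "\<exists>\<delta>>0. \<exists>C. \<forall>t eta l. t \<noteq> 0 \<and> \<bar>t\<bar> < \<delta> \<and> admissible_field (h t) (u t, 0) eta l \<longrightarrow>
            \<bar>sec_cusp_curv (h t) (u t, 0) eta l
               - (45 * sqrt 2 * c3 (0, 0, 0)
                  + 45 * sqrt 2 * deriv (\<lambda>x. c3 (x, 0, 0)) 0 / d20 * t)\<bar>
              \<le> C * t^2"
    proof -
      have "lin_exp (\<lambda>t. cusp_sec (partial_u FA (u t, - (t^2)))
          (partial_u FB (u t, - (t^2))) (c0 (u t, - (t^2))) (partial_u FC (u t, - (t^2)))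
          (k3 (u t, - (t^2)))) (45 * sqrt 2 * c3 (0, 0, 0)) (45 * sqrt 2 * deriv (\<lambda>x. c3 (x, 0, 0)) 0 / d20)"
        using lin_exp_cusp_sec[OF a b cc FC' curve[OF k(2)]] unfolding dk3 by (simp add: k3_def)
      then show ?thesis
        by (rule uniform_bound) (use inv in \<open>eventually_elim, simp\<close>)
    qed
  qed
qed

end
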